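(* Let $A\subset\mathbb Z^{d+1}$ be a homogeneous, non-pyramidal configuration of affine dimension $d$, of the form $A=\{(1,a'):a'\in A'\}$ with $A'\subset\mathbb Z^d$ a finite configuration whose differences generate $\mathbb Z^d$ as a group. Let $B$ be a Gale dual of $A$. If $B=B_0\cup B_1\cup\dots\cup B_r$ is any $\theta$-decomposition, then $$\lambda(A)=\sum_{j=0}^r(\dim L(B_j)-1).$$
   Context: Configurations are finite indexed families of not necessarily distinct vectors; a configuration $A=\{a_1,\dots,a_n\}$ is identified with the matrix with columns $a_i$; subconfigurations correspond to subsets of the index set. $A$ is homogeneous if $(1,\dots,1)$ lies in the rational row span of the matrix. $A$ is a pyramid if some affine hyperplane contains all points of $A$ except one (equivalently, some $a_i$ is not in the affine span of the other points); otherwise it is non-pyramidal. Gale dual: $B=\{b_1,\dots,b_n\}\subset\mathbb Q^m$, $m=n-d-1$, is the family of rows of a matrix whose columns are a basis of $\ker_{\mathbb Q}(A)$. For $C\subset B$, $L(C)$ is the $\mathbb Q$-linear span and $\mathfrak s(C)=\sum_{b\in C}b$; $C$ is dual-homogeneous if $\mathfrak s(C)=0$. Cayley decomposition of $B$ of length $r$: a partition $B=B_0\cup\dots\cup B_r$ into nonempty dual-homogeneous subconfigurations (these correspond to Cayley decompositions of $A$). Put $c(B_0,\dots,B_r)=\sum_{j=0}^r\dim L(B_j)-\dim L(B)$, and let $\theta(B)$ be the maximum of $r-c(B_0,\dots,B_r)$ over all Cayley decompositions of $B$ (all $r\ge0$). A $\theta$-decomposition is a Cayley decomposition with $r-c(B_0,\dots,B_r)=\theta(B)$.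 Flags: a flat of $B$ is a subfamily $F$ containing every element of $B$ lying in $L(F)$; its rank is $\dim L(F)$. A flag of length $\ell$ is a chain of flats $F_1\subset\dots\subset F_\ell$ with $\operatorname{rank}F_j=j$; it is non-splitting if $\mathfrak s(F_1)\neq0$ and $\mathfrak s(F_j)\notin L(F_{j-1})$ for $2\le j\le\ell$. $\lambda(A)=\lambda(B)$ is the maximal length of a non-splitting flag in $B$ ($0$ if there is none). *)

theory Defs
  imports
    "HOL-Analysis.Analysis"
    "HOL-Computational_Algebra.Group_Closure"
begin

text \<open>
  A configuration indexed by the finite type \<open>'n\<close> is a matrix: the points of \<open>A\<close> are the
  columns \<open>column i A\<close>, the vectors of a Gale dual \<open>B\<close> are the rows \<open>B $ i\<close>.  Repeated vectors
  are allowed, and subconfigurations are subsets of \<open>'n\<close>.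
\<close>

section \<open>Configurations of lattice points\<close>

abbreviation rat_matrix :: "int^'n^'k \<Rightarrow> rat^'n^'k" where
  "rat_matrix \<equiv> map_matrix rat_of_int"

definition homogeneous :: "int^'n^'k \<Rightarrow> bool" where
  "homogeneous A \<longleftrightarrow> (\<chi> i. 1) \<in> vec.span (rows (rat_matrix A))"

definition pyramid :: "int^'n^'k \<Rightarrow> bool" where
  "pyramid A \<longleftrightarrow>
     (\<exists>i (u :: rat^'k) c. u \<noteq> 0 \<and>
        (\<forall>j. j \<noteq> i \<longrightarrow> (\<Sum>k\<in>UNIV. u $ k * rat_matrix A $ k $ j) = c) \<and>
        (\<Sum>k\<in>UNIV. u $ k * rat_matrix A $ k $ i) \<noteq> c)"

definition affine_dimension :: "int^'n^'k \<Rightarrow> int" where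
  "affine_dimension A = aff_dim (columns (map_matrix real_of_int A))"

text \<open>
  Injectivity is part of the definition because \<open>columns B\<close> is a set and would not detect a
  repeated column.
\<close>

definition gale_dual :: "int^'n^'k \<Rightarrow> rat^'m^'n \<Rightarrow> bool" where
  "gale_dual A B \<longleftrightarrow>
     inj (\<lambda>j. column j B) \<and> vec.independent (columns B) \<and>
     vec.span (columns B) = {x. rat_matrix A *v x = 0}"

section \<open>Cayley decompositions\<close>

definition L :: "rat^'m^'n \<Rightarrow> 'n set \<Rightarrow> (rat^'m) set" where
  "L B C = vec.span ((\<lambda>i. B $ i) ` C)"

definition dim_L :: "rat^'m^'n \<Rightarrow> 'n set \<Rightarrow> nat" where
  "dim_L B C = vec.dim (L B C)"

definition vsum :: "rat^'m^'n \<Rightarrow> 'n set \<Rightarrow> rat^'m" where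
  "vsum B C = (\<Sum>i\<in>C. B $ i)"

definition dual_homogeneous :: "rat^'m^'n \<Rightarrow> 'n set \<Rightarrow> bool" where
  "dual_homogeneous B C \<longleftrightarrow> vsum B C = 0"

definition cayley_decomposition :: "rat^'m^'n \<Rightarrow> nat \<Rightarrow> (nat \<Rightarrow> 'n set) \<Rightarrow> bool" where
  "cayley_decomposition B r P \<longleftrightarrow>
     disjoint_family_on P {..r} \<and> (\<Union>j\<le>r. P j) = UNIV \<and>
     (\<forall>j\<le>r. P j \<noteq> {} \<and> dual_homogeneous B (P j))"

definition cayley_defect :: "rat^'m^'n \<Rightarrow> nat \<Rightarrow> (nat \<Rightarrow> 'n set) \<Rightarrow> int" where
  "cayley_defect B r P = (\<Sum>j\<le>r. int (dim_L B (P j))) - int (dim_L B UNIV)"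

definition theta :: "rat^'m^'n \<Rightarrow> int" where
  "theta B = Max {int r - cayley_defect B r P | r P. cayley_decomposition B r P}"

definition theta_decomposition :: "rat^'m^'n \<Rightarrow> nat \<Rightarrow> (nat \<Rightarrow> 'n set) \<Rightarrow> bool" where
  "theta_decomposition B r P \<longleftrightarrow>
     cayley_decomposition B r P \<and> int r - cayley_defect B r P = theta B"

section \<open>Non-splitting flags\<close>

definition flat :: "rat^'m^'n \<Rightarrow> 'n set \<Rightarrow> bool" where
  "flat B F \<longleftrightarrow> (\<forall>i. B $ i \<in> L B F \<longrightarrow> i \<in> F)"

text \<open>Only the values \<open>F 1, \<dots>, F l\<close> of the chain \<open>F\<close> matter.\<close>

definition flag :: "rat^'m^'n \<Rightarrow> nat \<Rightarrow> (nat \<Rightarrow> 'n set) \<Rightarrow> bool" where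
  "flag B l F \<longleftrightarrow>
     (\<forall>j\<in>{1..l}. flat B (F j) \<and> dim_L B (F j) = j) \<and>
     (\<forall>j\<in>{1..<l}. F j \<subset> F (Suc j))"

definition non_splitting :: "rat^'m^'n \<Rightarrow> nat \<Rightarrow> (nat \<Rightarrow> 'n set) \<Rightarrow> bool" where
  "non_splitting B l F \<longleftrightarrow>
     (1 \<le> l \<longrightarrow> vsum B (F 1) \<noteq> 0) \<and>
     (\<forall>j\<in>{2..l}. vsum B (F j) \<notin> L B (F (j - 1)))"

text \<open>The empty flag, \<open>l = 0\<close>, always qualifies, so the value is 0 if there is no other.\<close>

definition lambda :: "rat^'m^'n \<Rightarrow> nat" where
  "lambda B = Max {l. \<exists>F. flag B l F \<and> non_splitting B l F}"

end

theory Submission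
  imports Defs "HOL-Computational_Algebra.Polynomial"
begin

text \<open>
  Since \<open>\<Sum>j\<le>r. (dim L(B_j) - 1)\<close> equals \<open>dim L(B) - 1 - (r - c(B_0, \<dots>, B_r))\<close>, a
  \<open>\<theta>\<close>-decomposition is a Cayley decomposition for which this sum is smallest.  So the theorem
  is a min-max statement: the longest non-splitting flag is as long as the smallest value of the sum.
  From \<open>A\<close> come two properties of \<open>B\<close>: its vectors \<open>b_i\<close> are nonzero, because \<open>A\<close> is not a
  pyramid, and their sum is zero, because \<open>A\<close> has a row of ones.

  That no flag is longer than the sum for any decomposition is a counting argument
  (\<open>flag_length_le\<close>): every step of the flag is charged to a part of the decomposition, and a
  part \<open>B_j\<close> is charged at most \<open>dim L(B_j) - 1\<close> times.

  For the converse, regard the \<open>b_i\<close> as real vectors and consider the symmetric matrix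
  \<open>M(l) = \<Sum>i. b_i b_i\<^sup>T / (b_i \<bullet> l)\<close> at a point \<open>l\<close> where its corank takes its minimal value
  \<open>D\<close>.  With \<open>m\<close> the number of coordinates of the \<open>b_i\<close>, both a flag and a decomposition
  match the number \<open>m - D\<close>.

  \<^item> There is a non-splitting flag of length \<open>m - D\<close> (\<open>non_splitting_flag_exists\<close>).  Add the
    projection \<open>\<Psi>\<close> to the kernel of \<open>M(l)\<close> and let \<open>l\<close> run along a generic line.  The
    determinant of \<open>M(l) + \<Psi>\<close> is not zero at the start and tends to \<open>det \<Psi>\<close> at infinity.  As
    long as \<open>det \<Psi> = 0\<close>, the determinant must have a pole, which singles out a line spanned by
    some \<open>b_i\<close> such that the vectors on it have a nonzero sum.  This line is the first flat, and
    the argument continues in the contraction, with the dimension of the kernel of \<open>\<Psi>\<close>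
    lowered by at most one.

  \<^item> There is a Cayley decomposition whose sum is at most \<open>m - D\<close>
    (\<open>non_splitting_flag_matching_partition\<close>).  Choose \<open>l\<close> and a kernel vector \<open>u\<close> of \<open>M(l)\<close> such that
    the ratios \<open>q_i = (b_i \<bullet> u) / (b_i \<bullet> l)\<close> take as many different values as possible.
    Since the corank is constant near \<open>l\<close>, kernel vectors can be continued
    differentiably, and differentiating the kernel equation yields \<open>\<Sum>i. q_i\<^sup>k b_i = 0\<close> for all
    \<open>k\<close>.  So the level sets of \<open>q\<close> are dual-homogeneous.  Perturbing \<open>l\<close> once more shows that
    the hyperplanes orthogonal to \<open>l\<close> in the spans of the parts are linearly independent
    subspaces of the orthogonal complement of the kernel, which has dimension \<open>m - D\<close>.
\<close>

section \<open>Bounding flags by Cayley decompositions\<close>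

lemma dim_L_eq: "dim_L B C = vec.dim ((\<lambda>i. B $ i) ` C)"
  by (simp add: dim_L_def L_def)

lemma L_mono: "C \<subseteq> D \<Longrightarrow> L B C \<subseteq> L B D"
  unfolding L_def by (intro vec.span_mono image_mono)

lemma L_base: "i \<in> C \<Longrightarrow> B $ i \<in> L B C"
  unfolding L_def by (intro vec.span_base imageI)

lemma vsum_in_L: "C \<subseteq> D \<Longrightarrow> vsum B C \<in> L B D"
  unfolding vsum_def L_def by (intro vec.span_sum vec.span_base) auto

lemma dim_L_le_card: "dim_L B C \<le> CARD('m)" for B :: "rat^'m^'n"
  unfolding dim_L_def by (metis vec.dim_subset subset_UNIV vec_dim_card)

lemma dim_L_less:
  assumes "C \<subseteq> D" "x \<in> L B D" "x \<notin> L B C"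
  shows "dim_L B C < dim_L B D"
  unfolding dim_L_eq
  by (rule vec.dim_psubset) (use assms L_mono[OF assms(1), of B] in \<open>auto simp: L_def\<close>)

text \<open>
  Colour the step from \<open>F (j - 1)\<close> to \<open>F j\<close> by a part \<open>P i\<close> that witnesses the
  non-splitting condition: the sum over \<open>F j \<inter> P i\<close> does not lie in the span of the previous
  flat.  At the steps of colour \<open>i\<close> the dimension of the span of \<open>F j \<inter> P i\<close> increases, and it never
  reaches that of \<open>P i\<close>: otherwise \<open>F j\<close>, being a flat, would contain \<open>P i\<close>, whose sum is
  zero.  So at most \<open>dim_L B (P i) - 1\<close> steps have colour \<open>i\<close>.
\<close>
lemma flag_length_le:
  fixes B :: "rat^'m^'n" and P :: "nat \<Rightarrow> 'n set"
  assumes nonzero: "\<And>i. B $ i \<noteq> 0"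
    and P: "cayley_decomposition B r P" and F: "flag B l F" "non_splitting B l F"
  shows "int l \<le> (\<Sum>j\<le>r. int (dim_L B (P j)) - 1)"
proof -
  \<comment> \<open>Starting the chain with the empty flat turns the condition on \<open>F 1\<close> into an instance of the general one.\<close>
  define G where "G j = (if j = 0 then {} else F j)" for j :: nat
  have disj: "disjoint_family_on P {..r}" and cover: "(\<Union>j\<le>r. P j) = UNIV"
    and ne: "\<And>i. i \<le> r \<Longrightarrow> P i \<noteq> {}" and zero: "\<And>i. i \<le> r \<Longrightarrow> vsum B (P i) = 0"
    using P by (auto simp: cayley_decomposition_def dual_homogeneous_def)
  have flat: "i \<in> G j" if "j \<in> {1..l}" "B $ i \<in> L B (G j)" for i j
    using F(1) that by (auto simp: flag_def flat_def G_def)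
  have step: "G j \<subseteq> G (Suc j)" if "Suc j \<le> l" for j
    using F(1) that by (cases j) (auto simp: flag_def G_def)
  have mono: "G i \<subseteq> G j" if "i \<le> j" "j \<le> l" for i j
    using that by (induction j rule: dec_induct) (use step in force)+
  have split: "vsum B (G j) \<notin> L B (G (j - 1))" if "j \<in> {1..l}" for j
  proof (cases "j = 1")
    case True
    then show ?thesis using F(2) that by (simp add: non_splitting_def G_def L_def)
  next
    case False
    then show ?thesis using F(2) that by (auto simp: non_splitting_def G_def)
  qed
  have "\<exists>i\<le>r. vsum B (G j \<inter> P i) \<notin> L B (G (j - 1))" if "j \<in> {1..l}" for j
  proof (rule ccontr)
    assume neg: "\<not> ?thesis"
    have G: "G j = (\<Union>i\<in>{..r}. G j \<inter> P i)" using cover by auto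
    then have "vsum B (G j) = (\<Sum>i\<le>r. vsum B (G j \<inter> P i))"
      unfolding vsum_def using disj
      by (subst G, intro sum.UNION_disjoint) (auto simp: disjoint_family_on_def)
    also have "\<dots> \<in> L B (G (j - 1))"
      unfolding L_def by (rule vec.span_sum) (use neg in \<open>auto simp: L_def\<close>)
    finally show False using split[OF that] by blast
  qed
  then obtain \<kappa> where \<kappa>: "\<And>j. j \<in> {1..l} \<Longrightarrow> \<kappa> j \<le> r"
    "\<And>j. j \<in> {1..l} \<Longrightarrow> vsum B (G j \<inter> P (\<kappa> j)) \<notin> L B (G (j - 1))"
    by metis
  have colour: "int (card {j \<in> {1..l}. \<kappa> j = i}) \<le> int (dim_L B (P i)) - 1" if i: "i \<le> r" for i
  proof -
    let ?J = "{j \<in> {1..l}. \<kappa> j = i}"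
    let ?d = "\<lambda>j. dim_L B (G j \<inter> P i)"
    have less: "?d j < ?d j'" if "j \<in> ?J" "j' \<in> ?J" "j < j'" for j j'
    proof (rule dim_L_less)
      show "G j \<inter> P i \<subseteq> G j' \<inter> P i" using mono[of j j'] that by auto
      show "vsum B (G j' \<inter> P i) \<in> L B (G j' \<inter> P i)" by (rule vsum_in_L) simp
      have "L B (G j \<inter> P i) \<subseteq> L B (G (j' - 1))"
        using that by (intro L_mono le_infI1 mono) auto
      then show "vsum B (G j' \<inter> P i) \<notin> L B (G j \<inter> P i)" using \<kappa>(2)[of j'] that by auto
    qed
    then have inj: "inj_on ?d ?J"
      by (intro strict_mono_on_imp_inj_on strict_mono_onI)
    have "?d j \<in> {1..<dim_L B (P i)}" if j: "j \<in> ?J" for j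
    proof -
      have v: "vsum B (G j \<inter> P i) \<notin> L B (G (j - 1))" using \<kappa>(2)[of j] j by auto
      have "L B {} \<subseteq> L B (G (j - 1))" by (rule L_mono) simp
      then have "dim_L B {} < ?d j"
        using v by (intro dim_L_less[of _ _ "vsum B (G j \<inter> P i)"] vsum_in_L) auto
      moreover have "?d j < dim_L B (P i)"
      proof -
        have "\<exists>k\<in>P i. B $ k \<notin> L B (G j \<inter> P i)"
        proof (rule ccontr)
          assume "\<not> ?thesis"
          then have "P i \<subseteq> G j"
            using flat[of j] j L_mono[of "G j \<inter> P i" "G j" B] by blast
          then have "vsum B (G j \<inter> P i) = 0" using zero[OF i] by (simp add: Int_absorb1)
          then show False using v by (simp add: L_def vec.span_zero)
        qed
        then show ?thesis using dim_L_less[of "G j \<inter> P i" "P i"] L_base by blast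
      qed
      ultimately show ?thesis by simp
    qed
    then have "card ?J \<le> card {1..<dim_L B (P i)}"
      by (intro card_inj_on_le[OF inj]) auto
    moreover have "dim_L B (P i) \<noteq> 0"
    proof -
      obtain k where "k \<in> P i" using ne[OF i] by auto
      then have "dim_L B {} < dim_L B (P i)"
        using nonzero[of k] by (intro dim_L_less[of _ _ "B $ k"] L_base) (auto simp: L_def)
      then show ?thesis by simp
    qed
    ultimately show ?thesis by simp
  qed
  have "l = card {1..l}" by simp
  also have "\<dots> = (\<Sum>i\<le>r. card {j \<in> {1..l}. \<kappa> j = i})"
  proof -
    have "\<kappa> ` {1..l} \<subseteq> {..r}" using \<kappa>(1) by auto
    from sum.group[OF _ _ this, of "\<lambda>_. 1::nat"] show ?thesis by simp
  qed
  finally have "l = (\<Sum>i\<le>r. card {j \<in> {1..l}. \<kappa> j = i})" .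
  from arg_cong[OF this, of int]
  have "int l = (\<Sum>i\<le>r. int (card {j \<in> {1..l}. \<kappa> j = i}))" by (simp only: of_nat_sum)
  also have "\<dots> \<le> (\<Sum>i\<le>r. int (dim_L B (P i)) - 1)" by (intro sum_mono colour) simp
  finally show ?thesis .
qed

section \<open>Determinants\<close>

definition dyad :: "real^'m \<Rightarrow> real^'m \<Rightarrow> real^'m^'m" where
  "dyad u w = (\<chi> p q. u $ p * w $ q)"

lemma dyad_mult [simp]: "dyad u w *v x = (w \<bullet> x) *\<^sub>R u"
  by (simp add: vec_eq_iff dyad_def matrix_vector_mult_def inner_vec_def sum_distrib_left
      sum_distrib_right mult_ac)

lemma det_add_diagonal_entry:
  fixes Q :: "real^'m^'m"
  shows "det (Q + x *\<^sub>R dyad (axis k 1) (axis k 1))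
         = det Q + x * det (\<chi> i. if i = k then axis k 1 else Q $ i)"
proof -
  have "Q + x *\<^sub>R dyad (axis k 1) (axis k 1)
        = (\<chi> i. if i = k then Q $ i + x *s axis k 1 else Q $ i)"
    by (auto simp: vec_eq_iff dyad_def axis_def)
  also have "det \<dots> = det (\<chi> i. if i = k then Q $ i else Q $ i)
        + det (\<chi> i. if i = k then x *s axis k 1 else Q $ i)"
    by (rule det_row_add)
  also have "det (\<chi> i. if i = k then x *s axis k 1 else Q $ i)
        = x * det (\<chi> i. if i = k then axis k 1 else Q $ i)"
    by (rule det_row_mul)
  finally show ?thesis by simp
qed

lemma det_orthogonal_conjugate:
  fixes Q U :: "real^'m^'m"
  assumes "orthogonal_matrix U"
  shows "det (transpose U ** Q ** U) = det Q"
proof -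
  have "det U * det U = 1"
    using det_orthogonal_matrix[OF assms] by auto
  then show ?thesis by (simp add: det_mul det_transpose)
qed

text \<open>
  The determinant is affine along a rank-one direction.  In an orthonormal basis that contains
  \<open>e\<close> the perturbation changes one diagonal entry only; the slope is the determinant of
  \<open>Q\<close> with the row belonging to \<open>e\<close> replaced by \<open>e\<close> itself.
\<close>
lemma det_add_dyad_unit:
  fixes Q :: "real^'m^'m"
  assumes "norm e = 1"
  shows "det (Q + x *\<^sub>R dyad e e) = det Q + x * det (Q + dyad e (e - transpose Q *v e))"
proof -
  obtain U :: "real^'m^'m" and k where U: "orthogonal_matrix U" "U *v axis k 1 = e"
    using orthogonal_matrix_exists_basis[OF assms] by metis
  let ?c = "\<lambda>Z. transpose U ** Z ** U"
  have UU: "transpose U ** U = mat 1" "U ** transpose U = mat 1"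
    using U(1) by (auto simp: orthogonal_matrix_def)
  have e: "transpose U *v e = axis k 1"
    unfolding U(2)[symmetric] by (simp add: matrix_vector_mul_assoc UU)
  have dyad: "?c (dyad u w) = dyad (transpose U *v u) (transpose U *v w)" for u w
  proof (rule matrix_eq[THEN iffD2], rule allI)
    fix y
    show "?c (dyad u w) *v y = dyad (transpose U *v u) (transpose U *v w) *v y"
      by (simp add: matrix_vector_mul_assoc[symmetric] matrix_vector_mult_scaleR dot_lmul_matrix)
  qed
  have c_add: "?c (Z + x *\<^sub>R Z') = ?c Z + x *\<^sub>R ?c Z'" for Z Z' x
    by (rule matrix_eq[THEN iffD2]) (simp add: matrix_vector_mul_assoc[symmetric]
          matrix_vector_mult_add_rdistrib matrix_vector_mult_scaleR matrix_vector_right_distrib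
          scaleR_matrix_vector_assoc[symmetric])
  have row: "transpose U *v (transpose Q *v e) = ?c Q $ k"
  proof -
    have "transpose U *v (transpose Q *v e) = transpose (?c Q) *v axis k 1"
      by (simp add: matrix_transpose_mul matrix_vector_mul_assoc[symmetric] U(2))
    also have "\<dots> = ?c Q $ k"
      by (simp add: matrix_vector_mult_basis column_def transpose_def)
    finally show ?thesis .
  qed
  have 1: "?c (Q + dyad e (e - transpose Q *v e)) = (\<chi> i. if i = k then axis k 1 else ?c Q $ i)"
  proof -
    have "transpose U *v (e - transpose Q *v e) = axis k 1 - ?c Q $ k"
      by (simp only: matrix_vector_mult_diff_distrib e row)
    then have "?c (Q + dyad e (e - transpose Q *v e)) = ?c Q + dyad (axis k 1) (axis k 1 - ?c Q $ k)"
      using c_add[of Q 1 "dyad e (e - transpose Q *v e)"] by (simp only: dyad e scaleR_one)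
    then show ?thesis by (auto simp: vec_eq_iff dyad_def axis_def)
  qed
  have "det (Q + x *\<^sub>R dyad e e) = det (?c Q + x *\<^sub>R dyad (axis k 1) (axis k 1))"
    by (simp only: det_orthogonal_conjugate[OF U(1), symmetric, of "Q + x *\<^sub>R dyad e e"] c_add dyad e)
  also have "\<dots> = det (?c Q) + x * det (\<chi> i. if i = k then axis k 1 else ?c Q $ i)"
    by (rule det_add_diagonal_entry)
  also have "\<dots> = det Q + x * det (Q + dyad e (e - transpose Q *v e))"
    by (simp add: 1[symmetric] det_orthogonal_conjugate[OF U(1)])
  finally show ?thesis .
qed

lemma det_nonzero_iff_kernel:
  fixes Q :: "real^'m^'m"
  shows "det Q \<noteq> 0 \<longleftrightarrow> (\<forall>x. Q *v x = 0 \<longrightarrow> x = 0)"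
  by (metis invertible_det_nz invertible_left_inverse matrix_left_invertible_ker)

lemma det_differentiable:
  fixes Q :: "real \<Rightarrow> real^'m^'m"
  assumes "\<And>p q. (\<lambda>t. Q t $ p $ q) differentiable (at z)"
  shows "(\<lambda>t. det (Q t)) differentiable (at z)"
proof -
  have prod: "(\<lambda>t. \<Prod>i\<in>I. f i t) differentiable (at z)"
    if "\<And>i. (f i) differentiable (at z)" for I and f :: "'m \<Rightarrow> real \<Rightarrow> real"
    by (induction I rule: infinite_finite_induct) (auto intro!: differentiable_mult that)
  show ?thesis unfolding det_def
    by (intro differentiable_sum differentiable_mult prod assms ballI) auto
qed

section \<open>Rational functions without poles\<close>

text \<open>
  A rational function of a real variable with all poles in \<open>Z\<close>.  The list \<open>zs\<close> holds the
  zeros of a denominator with multiplicity.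
\<close>
definition rational_off :: "real set \<Rightarrow> (real \<Rightarrow> real) \<Rightarrow> bool" where
  "rational_off Z f \<longleftrightarrow>
     (\<exists>zs p. set zs \<subseteq> Z \<and> (\<forall>t. t \<notin> Z \<longrightarrow> f t * (\<Prod>z\<leftarrow>zs. t - z) = poly p t))"

lemma rational_off_const: "rational_off Z (\<lambda>t. c)"
  unfolding rational_off_def by (intro exI[of _ "[]"] exI[of _ "[:c:]"]) auto

lemma poly_prod_list_linear: "poly (\<Prod>z\<leftarrow>zs. [:- z, 1:]) t = (\<Prod>z\<leftarrow>zs. t - (z::real))"
  by (induction zs) (auto simp: algebra_simps)

lemma rational_off_add:
  assumes "rational_off Z f" "rational_off Z g"
  shows "rational_off Z (\<lambda>t. f t + g t)"
proof -
  obtain zs p ws q where *: "set zs \<subseteq> Z" "\<And>t. t \<notin> Z \<Longrightarrow> f t * (\<Prod>z\<leftarrow>zs. t - z) = poly p t"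
      "set ws \<subseteq> Z" "\<And>t. t \<notin> Z \<Longrightarrow> g t * (\<Prod>z\<leftarrow>ws. t - z) = poly q t"
    using assms unfolding rational_off_def by blast
  let ?l = "\<lambda>zs. \<Prod>z\<leftarrow>zs. [:- z, 1:]"
  show ?thesis unfolding rational_off_def
  proof (intro exI[of _ "zs @ ws"] exI[of _ "p * ?l ws + q * ?l zs"] conjI allI impI)
    fix t assume "t \<notin> Z"
    then show "(f t + g t) * (\<Prod>z\<leftarrow>zs @ ws. t - z) = poly (p * ?l ws + q * ?l zs) t"
      using *(2,4)[of t, symmetric] by (simp add: poly_prod_list_linear algebra_simps)
  qed (use * in auto)
qed

lemma rational_off_mult:
  assumes "rational_off Z f" "rational_off Z g"
  shows "rational_off Z (\<lambda>t. f t * g t)"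
proof -
  obtain zs p ws q where *: "set zs \<subseteq> Z" "\<And>t. t \<notin> Z \<Longrightarrow> f t * (\<Prod>z\<leftarrow>zs. t - z) = poly p t"
      "set ws \<subseteq> Z" "\<And>t. t \<notin> Z \<Longrightarrow> g t * (\<Prod>z\<leftarrow>ws. t - z) = poly q t"
    using assms unfolding rational_off_def by blast
  show ?thesis unfolding rational_off_def
  proof (intro exI[of _ "zs @ ws"] exI[of _ "p * q"] conjI allI impI)
    fix t assume "t \<notin> Z"
    then show "(f t * g t) * (\<Prod>z\<leftarrow>zs @ ws. t - z) = poly (p * q) t"
      using *(2,4)[of t, symmetric] by (simp add: algebra_simps)
  qed (use * in auto)
qed

lemma rational_off_sum:
  assumes "\<And>i. i \<in> I \<Longrightarrow> rational_off Z (f i)"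
  shows "rational_off Z (\<lambda>t. \<Sum>i\<in>I. f i t)"
  using assms
  by (induction I rule: infinite_finite_induct) (auto intro: rational_off_const rational_off_add)

lemma rational_off_prod:
  assumes "\<And>i. i \<in> I \<Longrightarrow> rational_off Z (f i)"
  shows "rational_off Z (\<lambda>t. \<Prod>i\<in>I. f i t)"
  using assms
  by (induction I rule: infinite_finite_induct) (auto intro: rational_off_const rational_off_mult)

lemma rational_off_inverse_linear:
  assumes "b \<noteq> 0" "- a / b \<in> Z"
  shows "rational_off Z (\<lambda>t. c / (a + t * b))"
  unfolding rational_off_def
proof (intro exI[of _ "[- a / b]"] exI[of _ "[:c / b:]"] conjI allI impI)
  fix t assume "t \<notin> Z"
  then have "a + t * b \<noteq> 0"
    using assms by (auto simp: field_simps add_eq_0_iff2)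
  moreover have "t - (- a / b) = (a + t * b) / b"
    using assms by (simp add: field_simps)
  ultimately show "c / (a + t * b) * (\<Prod>z\<leftarrow>[- a / b]. t - z) = poly [:c / b:] t"
    by simp
qed (use assms in auto)

lemma rational_off_det:
  assumes "\<And>p q. rational_off Z (\<lambda>t. Q t $ p $ q)"
  shows "rational_off Z (\<lambda>t. det (Q t :: real^'m^'m))"
  unfolding det_def
  by (intro rational_off_sum rational_off_mult rational_off_const rational_off_prod assms)

text \<open>
  A rational function without poles is a polynomial, and a polynomial that tends to \<open>0\<close> is
  \<open>0\<close>.  The formal denominator is cancelled one linear factor at a time: a finite limit at
  \<open>z\<close> forces the numerator to vanish there.
\<close>
lemma rational_off_vanishes:
  assumes "rational_off Z f" "finite Z"
    and finite_limits: "\<And>z. z \<in> Z \<Longrightarrow> \<exists>c. (f \<longlongrightarrow> c) (at z)"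
    and infinity: "(f \<longlongrightarrow> 0) at_top"
    and t: "t \<notin> Z"
  shows "f t = 0"
proof -
  have off: "eventually (\<lambda>t. t \<notin> Z) (at z)" for z
    using islimpt_finite[OF \<open>finite Z\<close>] islimpt_iff_eventually by blast
  have off_top: "eventually (\<lambda>t. t \<notin> Z) at_top"
  proof -
    obtain u where "\<And>z. z \<in> Z \<Longrightarrow> z \<le> u"
      using \<open>finite Z\<close> by (meson bdd_above_finite bdd_above_def)
    then show ?thesis
      using eventually_gt_at_top[of u] by (metis (mono_tags, lifting) eventually_mono not_le)
  qed
  obtain zs p where "set zs \<subseteq> Z" "\<And>t. t \<notin> Z \<Longrightarrow> f t * (\<Prod>z\<leftarrow>zs. t - z) = poly p t"
    using assms(1) unfolding rational_off_def by blast
  then show ?thesis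
  proof (induction zs arbitrary: p)
    case Nil
    then have "eventually (\<lambda>t. f t = poly p t) at_top"
      using off_top by (auto elim!: eventually_mono)
    then have lim: "((\<lambda>t. poly p t) \<longlongrightarrow> 0) at_top"
      using infinity tendsto_cong by fastforce
    have "p = 0"
    proof (rule ccontr)
      assume "p \<noteq> 0"
      show False
      proof (cases "degree p = 0")
        case True
        then obtain c where "p = [:c:]" by (rule degree_eq_zeroE)
        then show False using lim \<open>p \<noteq> 0\<close> by (simp add: tendsto_const_iff)
      next
        case False
        have "filterlim (poly p) at_infinity at_top"
          by (rule filterlim_mono[OF filterlim_poly_at_infinity[OF _] order_refl at_top_le_at_infinity])
             (use False in simp)
        then show False
          using lim not_tendsto_and_filterlim_at_infinity[OF trivial_limit_at_top_linorder] by blast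
      qed
    qed
    then show ?case using Nil.prems(2)[OF t] by simp
  next
    case (Cons z zs)
    let ?R = "\<lambda>t. \<Prod>z\<leftarrow>zs. t - z"
    obtain c where c: "(f \<longlongrightarrow> c) (at z)"
      using finite_limits Cons.prems(1) by auto
    have contR: "(?R \<longlongrightarrow> ?R z) (at z)"
      unfolding poly_prod_list_linear[symmetric] by (intro tendsto_intros)
    have "((\<lambda>t. f t * ((t - z) * ?R t)) \<longlongrightarrow> c * ((z - z) * ?R z)) (at z)"
      by (intro tendsto_intros c contR)
    moreover have "eventually (\<lambda>t. f t * ((t - z) * ?R t) = poly p t) (at z)"
      using off by (rule eventually_mono) (use Cons.prems(2) in auto)
    ultimately have "((\<lambda>t. poly p t) \<longlongrightarrow> 0) (at z)"
      using Lim_transform_eventually by fastforce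
    moreover have "((\<lambda>t. poly p t) \<longlongrightarrow> poly p z) (at z)"
      by (intro tendsto_intros)
    ultimately have "poly p z = 0"
      using tendsto_unique[OF trivial_limit_at] by blast
    then obtain p' where p': "p = [:- z, 1:] * p'"
      by (metis poly_eq_0_iff_dvd dvdE)
    show ?case
    proof (rule Cons.IH[of p'])
      fix t assume t: "t \<notin> Z"
      then have "t - z \<noteq> 0" using Cons.prems(1) by auto
      moreover have "(t - z) * (f t * ?R t) = (t - z) * poly p' t"
        using Cons.prems(2)[OF t] by (simp add: p' algebra_simps)
      ultimately show "f t * ?R t = poly p' t" by simp
    qed (use Cons.prems in auto)
  qed
qed

section \<open>The Hessian of a configuration and its poles\<close>

lemma det_tendsto:
  fixes Q :: "real \<Rightarrow> real^'m^'m"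
  assumes "\<And>p q. ((\<lambda>t. Q t $ p $ q) \<longlongrightarrow> R $ p $ q) F"
  shows "((\<lambda>t. det (Q t)) \<longlongrightarrow> det R) F"
  unfolding det_def by (intro tendsto_sum tendsto_mult tendsto_const tendsto_prod assms)

text \<open>
  This is the Hessian matrix at \<open>l\<close> of \<open>\<Sum>i. (b i \<bullet> l) * ln (b i \<bullet> l)\<close>.  A vector
  \<open>b i = 0\<close> contributes \<open>0\<close>, so contracted elements can be kept in the index type.
\<close>
definition hess :: "('n::finite \<Rightarrow> real^'m) \<Rightarrow> real^'m \<Rightarrow> real^'m^'m" where
  "hess b l = (\<chi> p q. \<Sum>i\<in>UNIV. b i $ p * b i $ q / (b i \<bullet> l))"

lemma hess_mult: "hess b l *v x = (\<Sum>i\<in>UNIV. (b i \<bullet> x / (b i \<bullet> l)) *\<^sub>R b i)"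
proof -
  have "(hess b l *v x) $ p = (\<Sum>i\<in>UNIV. (b i \<bullet> x / (b i \<bullet> l)) *\<^sub>R b i) $ p" for p
  proof -
    have "(hess b l *v x) $ p = (\<Sum>q\<in>UNIV. \<Sum>i\<in>UNIV. b i $ p * b i $ q / (b i \<bullet> l) * x $ q)"
      by (simp add: hess_def matrix_vector_mult_def sum_distrib_right)
    also have "\<dots> = (\<Sum>i\<in>UNIV. \<Sum>q\<in>UNIV. b i $ p * b i $ q / (b i \<bullet> l) * x $ q)"
      by (rule sum.swap)
    also have "\<dots> = (\<Sum>i\<in>UNIV. (b i \<bullet> x / (b i \<bullet> l)) *\<^sub>R b i) $ p"
      by (simp add: inner_vec_def[of _ x] sum_distrib_left sum_distrib_right sum_divide_distrib mult_ac)
    finally show ?thesis .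
  qed
  then show ?thesis by (simp add: vec_eq_iff)
qed

lemma inner_nonzero_on_finite_set:
  fixes S :: "('a::euclidean_space) set"
  assumes "finite S" "0 \<notin> S"
  shows "\<exists>y. \<forall>a\<in>S. a \<bullet> y \<noteq> 0"
  using assms
proof (induction S rule: finite_induct)
  case (insert a S)
  then obtain y where y: "\<forall>d\<in>S. d \<bullet> y \<noteq> 0" by auto
  \<comment> \<open>On the line through \<open>y\<close> with direction \<open>a\<close> each condition excludes at most one point.\<close>
  let ?bad = "\<Union>d\<in>insert a S. {- (d \<bullet> y) / (d \<bullet> a)}"
  have "finite ?bad" using insert.hyps by simp
  then obtain s :: real where s: "s \<notin> ?bad"
    by (metis ex_new_if_finite infinite_UNIV_char_0)
  have "d \<bullet> (y + s *\<^sub>R a) \<noteq> 0" if "d \<in> insert a S" for d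
  proof
    assume 0: "d \<bullet> (y + s *\<^sub>R a) = 0"
    show False
    proof (cases "d \<bullet> a = 0")
      case True
      then have "d \<noteq> a" using insert.prems by auto
      then show False using 0 True y that by (auto simp: inner_add_right)
    next
      case False
      then have "s = - (d \<bullet> y) / (d \<bullet> a)"
        using 0 by (simp add: inner_add_right field_simps)
      then show False using s that by blast
    qed
  qed
  then show ?case by blast
qed auto

text \<open>
  Move \<open>l0\<close> along a generic line and follow \<open>det (hess b l + \<Psi>)\<close>.  It is not \<open>0\<close> at the
  start and tends to \<open>det \<Psi> = 0\<close> at infinity, because \<open>hess b\<close> is homogeneous of degree
  \<open>-1\<close>; so it has a pole.  The line meets the hyperplanes orthogonal to the \<open>b i\<close> one at a
  time, hence the pole belongs to a single direction \<open>e\<close>.  The singular part of the matrix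
  there is a multiple of \<open>dyad e e\<close> whose factor is the sum of the vectors on the line
  \<open>span {e}\<close>; a pole is only possible if this sum and the slope from
  \<open>det_add_dyad_unit\<close> are both nonzero.
\<close>
lemma hess_pole:
  fixes b :: "'n::finite \<Rightarrow> real^'m"
  assumes l0: "\<And>i. b i \<noteq> 0 \<Longrightarrow> b i \<bullet> l0 \<noteq> 0"
    and regular: "det (hess b l0 + \<Psi>) \<noteq> 0" and singular: "det \<Psi> = 0"
  obtains e l Q where "norm e = 1" "\<exists>i. b i \<noteq> 0 \<and> b i \<in> span {e}"
    "(\<Sum>i | b i \<in> span {e}. b i) \<noteq> 0" "e \<bullet> l = 0" "\<And>i. b i \<notin> span {e} \<Longrightarrow> b i \<bullet> l \<noteq> 0"
    "Q = hess (\<lambda>i. if b i \<in> span {e} then 0 else b i) l + \<Psi>"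
    "det (Q + dyad e (e - transpose Q *v e)) \<noteq> 0"
proof -
  \<comment> \<open>The second family separates the points at which the line meets different hyperplanes.\<close>
  let ?S = "(range b \<union> (\<Union>i. \<Union>j. {(b i \<bullet> l0) *\<^sub>R b j - (b j \<bullet> l0) *\<^sub>R b i})) - {0}"
  have "\<exists>m. \<forall>a\<in>?S. a \<bullet> m \<noteq> 0"
    by (rule inner_nonzero_on_finite_set) auto
  then obtain m where m: "\<And>a. a \<in> ?S \<Longrightarrow> a \<bullet> m \<noteq> 0" by blast
  have m1: "b i \<bullet> m \<noteq> 0" if "b i \<noteq> 0" for i using m that by blast
  define z where "z i = - (b i \<bullet> l0) / (b i \<bullet> m)" for i
  define Z where "Z = z ` {i. b i \<noteq> 0}"
  define f where "f t = det (hess b (l0 + t *\<^sub>R m) + \<Psi>)" for t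
  have lin: "b i \<bullet> (l0 + t *\<^sub>R m) = b i \<bullet> l0 + t * (b i \<bullet> m)" for i t
    by (simp add: inner_add_right)
  have "rational_off Z f"
  proof -
    have "rational_off Z (\<lambda>t. b i $ p * b i $ q / (b i \<bullet> (l0 + t *\<^sub>R m)))" for i p q
    proof (cases "b i = 0")
      case False
      then show ?thesis unfolding lin
        by (intro rational_off_inverse_linear m1) (auto simp: Z_def z_def)
    qed (simp add: rational_off_const)
    then show ?thesis
      unfolding f_def hess_def
      by (intro rational_off_det)
         (auto intro!: rational_off_add rational_off_sum rational_off_const)
  qed
  moreover have "finite Z" by (simp add: Z_def)
  moreover have "0 \<notin> Z" using l0 m1 by (auto simp: Z_def z_def)
  moreover have "f 0 \<noteq> 0" using regular by (simp add: f_def)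
  moreover have "(f \<longlongrightarrow> 0) at_top"
  proof -
    have each: "((\<lambda>t. b i $ p * b i $ q / (b i \<bullet> (l0 + t *\<^sub>R m))) \<longlongrightarrow> 0) at_top" for i p q
    proof (cases "b i = 0")
      case False
      have "filterlim (\<lambda>t. b i \<bullet> l0 + (b i \<bullet> m) * t) at_infinity at_top"
        by (intro tendsto_add_filterlim_at_infinity[OF tendsto_const]
              tendsto_mult_filterlim_at_infinity[OF tendsto_const m1[OF False]]
              filterlim_at_top_imp_at_infinity filterlim_ident)
      then show ?thesis unfolding lin mult.commute[of _ "b i \<bullet> m"]
        by (intro tendsto_divide_0[OF tendsto_const])
    qed simp
    have "((\<lambda>t. hess b (l0 + t *\<^sub>R m) $ p $ q) \<longlongrightarrow> (\<Sum>i\<in>(UNIV::'n set). 0)) at_top" for p q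
      unfolding hess_def vec_lambda_beta by (intro tendsto_sum each)
    then have "(f \<longlongrightarrow> det \<Psi>) at_top"
      unfolding f_def
      by (intro det_tendsto) (auto intro: tendsto_add[of _ 0, simplified])
    then show ?thesis by (simp add: singular)
  qed
  ultimately obtain i where i: "b i \<noteq> 0" "\<nexists>c. (f \<longlongrightarrow> c) (at (z i))"
    using rational_off_vanishes[of Z f 0] unfolding Z_def by auto
  define e where "e = b i /\<^sub>R norm (b i)"
  define l where "l = l0 + z i *\<^sub>R m"
  define J where "J = {j. b j \<in> span {e}}"
  define c where "c j = (if b j \<in> span {e} then 0 else b j)" for j
  define Q where "Q t = hess c (l0 + t *\<^sub>R m) + \<Psi>" for t
  define \<beta> where "\<beta> t = det (Q t + dyad e (e - transpose (Q t) *v e))" for t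
  define a where "a = (\<Sum>j\<in>J. b j \<bullet> e)"
  have e: "norm e = 1" "e \<bullet> e = 1" "e \<noteq> 0"
    using i(1) by (auto simp: e_def dot_square_norm power2_eq_square)
  have bi: "b i = norm (b i) *\<^sub>R e" using i(1) by (simp add: e_def)
  have J: "b j = (b j \<bullet> e) *\<^sub>R e" if "j \<in> J" for j
    using that e(2) by (auto simp: J_def span_singleton)
  have em: "e \<bullet> m \<noteq> 0" using m1[OF i(1)] by (auto simp: e_def)
  have el: "e \<bullet> (l0 + t *\<^sub>R m) = (t - z i) * (e \<bullet> m)" for t
    using em i(1) by (simp add: e_def z_def inner_add_right field_simps)
  have off: "b j \<bullet> l \<noteq> 0" if "b j \<notin> span {e}" for j
  proof
    assume 0: "b j \<bullet> l = 0"
    have "b j \<noteq> 0" using that span_zero by metis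
    then have "b j \<bullet> m \<noteq> 0" by (rule m1)
    then have "((b i \<bullet> l0) *\<^sub>R b j - (b j \<bullet> l0) *\<^sub>R b i) \<bullet> m = 0"
      using 0 m1[OF i(1)] by (simp add: l_def z_def inner_add_right inner_diff_left inner_diff_right field_simps)
    then have "(b i \<bullet> l0) *\<^sub>R b j = (b j \<bullet> l0) *\<^sub>R b i"
      using m by force
    then have "b j = ((b j \<bullet> l0) / (b i \<bullet> l0)) *\<^sub>R b i"
      using l0[OF i(1)] by (metis divide_inverse_commute real_vector_affinity_eq scaleR_scaleR
          vector_fraction_eq_iff)
    then have "b j = ((b j \<bullet> l0) / (b i \<bullet> l0) * norm (b i)) *\<^sub>R e"
      using bi by (metis scaleR_scaleR)
    then show False using that by (metis span_base span_mul insertI1)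
  qed
  have sumJ: "(\<Sum>j\<in>J. b j) = a *\<^sub>R e"
    unfolding a_def scaleR_sum_left by (rule sum.cong[OF refl J])
  \<comment> \<open>The vectors on the line of \<open>e\<close> contribute exactly the multiple of \<open>dyad e e\<close> that is singular at \<open>z i\<close>.\<close>
  have f_eq: "f t = det (Q t) + a / ((t - z i) * (e \<bullet> m)) * \<beta> t" if "t \<noteq> z i" for t
  proof -
    have "hess b (l0 + t *\<^sub>R m) *v x
        = (hess c (l0 + t *\<^sub>R m) + (a / ((t - z i) * (e \<bullet> m))) *\<^sub>R dyad e e) *v x" for x
    proof -
      let ?l = "l0 + t *\<^sub>R m"
      let ?g = "\<lambda>b j. (b j \<bullet> x / (b j \<bullet> ?l)) *\<^sub>R (b j :: real^'m)"
      have "(\<Sum>j\<in>J. ?g b j) = (\<Sum>j\<in>J. ((b j \<bullet> e) * ((e \<bullet> x) / ((t - z i) * (e \<bullet> m)))) *\<^sub>R e)"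
      proof (rule sum.cong[OF refl])
        fix j assume "j \<in> J"
        define s where "s = b j \<bullet> e"
        have bj: "b j = s *\<^sub>R e" using J[OF \<open>j \<in> J\<close>] by (simp add: s_def)
        show "?g b j = ((b j \<bullet> e) * ((e \<bullet> x) / ((t - z i) * (e \<bullet> m)))) *\<^sub>R e"
          unfolding bj using that em by (simp add: e(2) el)
      qed
      also have "\<dots> = (a / ((t - z i) * (e \<bullet> m)) * (e \<bullet> x)) *\<^sub>R e"
        by (simp add: scaleR_sum_left[symmetric] sum_distrib_right sum_divide_distrib a_def)
      finally have 1: "(\<Sum>j\<in>J. ?g b j) = (a / ((t - z i) * (e \<bullet> m)) * (e \<bullet> x)) *\<^sub>R e" .
      have "(\<Sum>j\<in>UNIV. ?g b j) = (\<Sum>j\<in>- J. ?g b j) + (\<Sum>j\<in>J. ?g b j)"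
        using sum.subset_diff[of J UNIV "?g b"] by (simp add: Compl_eq_Diff_UNIV)
      also have "(\<Sum>j\<in>- J. ?g b j) = (\<Sum>j\<in>- J. ?g c j)"
        by (rule sum.cong) (auto simp: J_def c_def)
      also have "\<dots> = (\<Sum>j\<in>UNIV. ?g c j)"
        by (rule sum.mono_neutral_left) (auto simp: J_def c_def)
      finally show ?thesis
        by (simp add: hess_mult 1 matrix_vector_mult_add_rdistrib scaleR_matrix_vector_assoc[symmetric])
    qed
    then have "hess b (l0 + t *\<^sub>R m) + \<Psi> = Q t + (a / ((t - z i) * (e \<bullet> m))) *\<^sub>R dyad e e"
      by (simp add: Q_def matrix_eq matrix_vector_mult_add_rdistrib)
    then show ?thesis by (simp add: f_def \<beta>_def det_add_dyad_unit[OF e(1)])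
  qed
  have Q_diff: "(\<lambda>t. Q t $ p $ q) differentiable (at (z i))" for p q
  proof -
    have "(\<lambda>t. c j $ p * c j $ q / (c j \<bullet> (l0 + t *\<^sub>R m))) differentiable (at (z i))" for j
    proof (cases "b j \<in> span {e}")
      case False
      then show ?thesis unfolding c_def
        using off by (auto intro!: derivative_intros simp: lin l_def)
    qed (simp add: c_def)
    then show ?thesis by (simp add: Q_def hess_def differentiable_add differentiable_sum)
  qed
  have \<beta>_diff: "\<beta> differentiable (at (z i))"
    unfolding \<beta>_def
    by (rule det_differentiable)
       (auto simp: dyad_def matrix_vector_mult_def transpose_def
         intro!: derivative_intros Q_diff)
  have lim_Q: "((\<lambda>t. det (Q t)) \<longlongrightarrow> det (Q (z i))) (at (z i))"
    using det_differentiable[OF Q_diff] differentiable_imp_continuous_within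
    unfolding continuous_within by blast
  have ne: "a \<noteq> 0 \<and> \<beta> (z i) \<noteq> 0"
  proof (rule ccontr)
    \<comment> \<open>If \<open>\<beta> (z i) = 0\<close>, the simple pole cancels and its limit is given by the derivative of \<open>\<beta>\<close>.\<close>
    assume neg: "\<not> (a \<noteq> 0 \<and> \<beta> (z i) \<noteq> 0)"
    then have "\<exists>d. ((\<lambda>t. a / ((t - z i) * (e \<bullet> m)) * \<beta> t) \<longlongrightarrow> d) (at (z i))"
    proof (cases "a = 0")
      case False
      then have 0: "\<beta> (z i) = 0" using neg by auto
      obtain D where "(\<beta> has_real_derivative D) (at (z i))"
        using \<beta>_diff real_differentiable_def by blast
      then have "((\<lambda>t. (\<beta> t - \<beta> (z i)) / (t - z i)) \<longlongrightarrow> D) (at (z i))"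
        by (simp add: has_field_derivative_iff)
      then have "((\<lambda>t. a / (e \<bullet> m) * ((\<beta> t - \<beta> (z i)) / (t - z i))) \<longlongrightarrow> a / (e \<bullet> m) * D) (at (z i))"
        by (intro tendsto_intros)
      then show ?thesis by (auto simp: 0 mult.commute)
    qed auto
    then obtain d where "((\<lambda>t. a / ((t - z i) * (e \<bullet> m)) * \<beta> t) \<longlongrightarrow> d) (at (z i))" ..
    then have "((\<lambda>t. det (Q t) + a / ((t - z i) * (e \<bullet> m)) * \<beta> t) \<longlongrightarrow> det (Q (z i)) + d) (at (z i))"
      by (intro tendsto_intros lim_Q)
    then have "(f \<longlongrightarrow> det (Q (z i)) + d) (at (z i))"
      by (rule Lim_transform_eventually) (simp add: eventually_at_filter f_eq)
    then show False using i(2) by blast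
  qed
  show thesis
  proof (rule that[of e l "Q (z i)"])
    show "\<exists>i. b i \<noteq> 0 \<and> b i \<in> span {e}"
      using i(1) bi by (metis span_base span_mul insertI1)
    show "(\<Sum>i | b i \<in> span {e}. b i) \<noteq> 0" using sumJ ne e by (simp add: J_def)
    show "e \<bullet> l = 0" by (simp add: l_def el)
    show "Q (z i) = hess (\<lambda>i. if b i \<in> span {e} then 0 else b i) l + \<Psi>"
      by (simp add: Q_def l_def c_def[abs_def])
    show "det (Q (z i) + dyad e (e - transpose (Q (z i)) *v e)) \<noteq> 0"
      using ne by (simp add: \<beta>_def)
  qed (use e off in auto)
qed


section \<open>Contractions and flags\<close>

definition project_along :: "real^'m \<Rightarrow> real^'m \<Rightarrow> real^'m" where
  "project_along e x = x - (e \<bullet> x) *\<^sub>R e"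

lemma linear_project_along: "linear (project_along e)"
  by (auto simp: project_along_def inner_add_right algebra_simps intro!: linearI)

lemma inner_project_along:
  "project_along e x \<bullet> y = x \<bullet> project_along e y"
  by (simp add: project_along_def inner_diff_left inner_diff_right inner_commute)

lemma project_along_eq_0:
  assumes "norm e = 1"
  shows "project_along e x = 0 \<longleftrightarrow> x \<in> span {e}"
proof -
  have "e \<bullet> e = 1" using assms by (simp add: dot_square_norm)
  then show ?thesis by (auto simp: project_along_def span_singleton)
qed

lemma inner_project_along_self:
  assumes "norm e = 1"
  shows "e \<bullet> project_along e x = 0"
  using assms by (simp add: project_along_def inner_diff_right dot_square_norm)

lemma subspace_kernel: "subspace {x. (M :: real^'m^'m) *v x = 0}"
  by (auto simp: subspace_def matrix_vector_right_distrib matrix_vector_mult_scaleR)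

text \<open>
  The nonzero slope at a pole says that \<open>Q\<close> is nondegenerate as a form on the hyperplane
  orthogonal to \<open>e\<close>.  Contracting the line of \<open>e\<close> means projecting all vectors to that
  hyperplane, and there \<open>Q\<close> is again of the form \<open>hess + \<Psi>'\<close>.  The summand
  \<open>(e \<bullet> y) *\<^sub>R e\<close> makes up for the lost dimension, so that everything stays in the same
  space; it costs at most one dimension of the kernel of \<open>\<Psi>\<close>.
\<close>
lemma hess_contraction:
  fixes b :: "'n::finite \<Rightarrow> real^'m"
  assumes e: "norm e = 1" and l: "e \<bullet> l = 0"
    and Q: "Q = hess (\<lambda>i. if b i \<in> span {e} then 0 else b i) l + \<Psi>"
    and regular: "det (Q + dyad e (e - transpose Q *v e)) \<noteq> 0"
  defines "\<Psi>' \<equiv> matrix (\<lambda>y. project_along e (\<Psi> *v project_along e y) + (e \<bullet> y) *\<^sub>R e)"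
  shows "det (hess (project_along e \<circ> b) l + \<Psi>') \<noteq> 0"
    and "dim {x. \<Psi> *v x = 0} \<le> Suc (dim {x. \<Psi>' *v x = 0})"
proof -
  interpret P: linear "project_along e" by (rule linear_project_along)
  have ee: "e \<bullet> e = 1" using e by (simp add: dot_square_norm)
  have \<Psi>': "\<Psi>' *v y = project_along e (\<Psi> *v project_along e y) + (e \<bullet> y) *\<^sub>R e" for y
  proof -
    have "linear (\<lambda>y. project_along e (\<Psi> *v project_along e y) + (e \<bullet> y) *\<^sub>R e)"
      by (auto intro!: linearI simp: P.add P.scaleR matrix_vector_right_distrib
          matrix_vector_mult_scaleR inner_add_right algebra_simps)
    from fun_cong[OF matrix_vector_mul(2)[OF this]] show ?thesis unfolding \<Psi>'_def .
  qed
  have bl: "project_along e x \<bullet> l = x \<bullet> l" for x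
    by (simp add: project_along_def inner_diff_left l)
  let ?c = "\<lambda>i. if b i \<in> span {e} then 0 else b i"
  have hess: "hess (project_along e \<circ> b) l *v y
      = project_along e (hess ?c l *v project_along e y)" for y
  proof -
    have c: "project_along e (?c i) = project_along e (b i)" for i
      using project_along_eq_0[OF e] by (auto simp: P.zero)
    have "(b i \<bullet> project_along e y / (b i \<bullet> l)) *\<^sub>R project_along e (b i)
        = (?c i \<bullet> project_along e y / (?c i \<bullet> l)) *\<^sub>R project_along e (?c i)" for i
      using project_along_eq_0[OF e] by (cases "b i \<in> span {e}") (auto simp: P.zero)
    then show ?thesis
      by (simp only: hess_mult P.sum P.scaleR o_def bl inner_project_along[of e _ y])
  qed
  show "det (hess (project_along e \<circ> b) l + \<Psi>') \<noteq> 0"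
    unfolding det_nonzero_iff_kernel
  proof (intro allI impI)
    fix y assume "(hess (project_along e \<circ> b) l + \<Psi>') *v y = 0"
    then have 0: "project_along e (Q *v project_along e y) + (e \<bullet> y) *\<^sub>R e = 0"
      by (simp add: matrix_vector_mult_add_rdistrib hess \<Psi>' Q P.add add.assoc)
    then have "e \<bullet> (project_along e (Q *v project_along e y) + (e \<bullet> y) *\<^sub>R e) = 0"
      by simp
    then have ey: "e \<bullet> y = 0"
      by (simp add: inner_add_right inner_project_along_self[OF e] ee)
    then have "project_along e y = y" by (simp add: project_along_def)
    with 0 ey have "project_along e (Q *v y) = 0" by simp
    moreover have "(e - transpose Q *v e) \<bullet> y = - (e \<bullet> (Q *v y))"
      by (simp add: inner_diff_left dot_lmul_matrix ey)
    ultimately have "(Q + dyad e (e - transpose Q *v e)) *v y = 0"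
      by (simp only: matrix_vector_mult_add_rdistrib project_along_def dyad_mult) simp
    then show "y = 0" using regular unfolding det_nonzero_iff_kernel by blast
  qed
  have sube: "subspace {x. e \<bullet> x = 0}" by (rule subspace_hyperplane)
  have "dim {x. \<Psi> *v x = 0} + dim {x. e \<bullet> x = 0}
      = dim {x + y |x y. x \<in> {x. \<Psi> *v x = 0} \<and> y \<in> {x. e \<bullet> x = 0}}
        + dim ({x. \<Psi> *v x = 0} \<inter> {x. e \<bullet> x = 0})"
    using dim_sums_Int[OF subspace_kernel[of \<Psi>] sube] by simp
  moreover have "dim {x. e \<bullet> x = 0} = CARD('m) - 1"
    using dim_hyperplane[of e] ee by (cases "e = 0") auto
  moreover have "dim {x + y |x y. x \<in> {x. \<Psi> *v x = 0} \<and> y \<in> {x. e \<bullet> x = 0}} \<le> CARD('m)"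
    using dim_subset_UNIV[of "{x + y |x y. x \<in> {x. \<Psi> *v x = 0} \<and> y \<in> {x. e \<bullet> x = 0}}"] by simp
  moreover have "dim ({x. \<Psi> *v x = 0} \<inter> {x. e \<bullet> x = 0}) \<le> dim {x. \<Psi>' *v x = 0}"
    by (rule dim_subset) (auto simp: \<Psi>' project_along_def P.zero)
  ultimately show "dim {x. \<Psi> *v x = 0} \<le> Suc (dim {x. \<Psi>' *v x = 0})" by linarith
qed

text \<open>
  Over the reals, the conditions that make a chain a flag and those that make it non-splitting form
  one notion, because the induction on the length establishes them together.
\<close>
definition non_splitting_flag :: "('n \<Rightarrow> real^'m) \<Rightarrow> nat \<Rightarrow> (nat \<Rightarrow> 'n set) \<Rightarrow> bool" where
  "non_splitting_flag b k F \<longleftrightarrow>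
     (\<forall>j\<in>{1..k}. (\<forall>i. b i \<in> span (b ` F j) \<longrightarrow> i \<in> F j) \<and> dim (b ` F j) = j) \<and>
     (\<forall>j\<in>{1..<k}. F j \<subset> F (Suc j)) \<and>
     (1 \<le> k \<longrightarrow> sum b (F 1) \<noteq> 0) \<and>
     (\<forall>j\<in>{2..k}. sum b (F j) \<notin> span (b ` F (j - 1)))"

text \<open>
  A flag of the contraction, preceded by the contracted line, is a flag of the configuration.
  The non-splitting condition is preserved since the projection kills exactly \<open>span {e}\<close>,
  which lies in the span of every flat involved.
\<close>
lemma non_splitting_flag_lift:
  fixes b :: "'n::finite \<Rightarrow> real^'m"
  assumes e: "norm e = 1" and i0: "b i0 \<noteq> 0" "b i0 \<in> span {e}"
    and s: "(\<Sum>i | b i \<in> span {e}. b i) \<noteq> 0"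
    and F: "non_splitting_flag (project_along e \<circ> b) k F"
  shows "non_splitting_flag b (Suc k) (\<lambda>j. if j \<le> 1 then {i. b i \<in> span {e}} else F (j - 1))"
proof -
  interpret P: linear "project_along e" by (rule linear_project_along)
  let ?b' = "project_along e \<circ> b"
  define G where "G = {i. b i \<in> span {e}}"
  have ee: "e \<bullet> e = 1" using e by (simp add: dot_square_norm)
  have e_in: "e \<in> span {b i0}"
  proof -
    obtain c where c: "b i0 = c *\<^sub>R e" using i0(2) by (auto simp: span_singleton)
    then have "e = inverse c *\<^sub>R b i0" using i0(1) by auto
    then show ?thesis by (metis span_base span_mul insertI1)
  qed
  have i0G: "i0 \<in> G" using i0 by (simp add: G_def)
  have spanG: "span (b ` G) = span {e}"
  proof
    show "span (b ` G) \<subseteq> span {e}" by (rule span_minimal) (auto simp: G_def)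
    show "span {e} \<subseteq> span (b ` G)"
      using e_in span_mono[of "{b i0}" "b ` G"] i0G by (intro span_minimal) auto
  qed
  have P_span: "project_along e x \<in> span (?b' ` C)" if "x \<in> span (b ` C)" for x C
    using that span_linear_image[OF linear_project_along, of e "b ` C"] by (auto simp: image_comp)
  have flat: "?b' i \<in> span (?b' ` F j) \<Longrightarrow> i \<in> F j" and rk: "dim (?b' ` F j) = j"
    if "j \<in> {1..k}" for i j
    using F that unfolding non_splitting_flag_def by blast+
  have first: "sum ?b' (F 1) \<noteq> 0" if "1 \<le> k"
    using F that unfolding non_splitting_flag_def by blast
  have nonsplit: "sum ?b' (F j) \<notin> span (?b' ` F (j - 1))" if "j \<in> {2..k}" for j
    using F that unfolding non_splitting_flag_def by blast
  have G_sub: "G \<subseteq> F j" if "j \<in> {1..k}" for j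
  proof
    fix i assume "i \<in> G"
    then have "?b' i = 0" using project_along_eq_0[OF e] by (simp add: G_def)
    then have "?b' i \<in> span (?b' ` F j)" by (simp only: span_zero)
    then show "i \<in> F j" by (rule flat[OF that])
  qed
  have dim_F: "dim (b ` F j) = Suc j" if "j \<in> {1..k}" for j
  proof -
    let ?V = "span (?b' ` F j)"
    have orth: "e \<bullet> x = 0" if "x \<in> ?V" for x
      using that by (rule span_induct)
        (auto simp: subspace_hyperplane inner_project_along_self[OF e])
    have "e \<notin> ?V" using orth[of e] ee by auto
    then have "dim (insert e (?b' ` F j)) = Suc j"
      using rk[OF that] by (simp add: dim_insert)
    moreover have "span (b ` F j) = span (insert e (?b' ` F j))"
    proof
      have "b i \<in> span (insert e (?b' ` F j))" if "i \<in> F j" for i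
      proof -
        have "b i = ?b' i + (e \<bullet> b i) *\<^sub>R e" by (simp add: project_along_def)
        then show ?thesis using that by (metis image_eqI insertCI span_add span_base span_mul)
      qed
      then show "span (b ` F j) \<subseteq> span (insert e (?b' ` F j))"
        by (intro span_minimal) auto
      have e: "e \<in> span (b ` F j)"
        using e_in span_mono[of "{b i0}" "b ` F j"] i0G G_sub[OF that] by auto
      have "?b' i \<in> span (b ` F j)" if "i \<in> F j" for i
        using that e by (simp add: project_along_def span_base span_diff span_mul)
      then show "span (insert e (?b' ` F j)) \<subseteq> span (b ` F j)"
        using e by (intro span_minimal) auto
    qed
    ultimately show ?thesis by (metis dim_span)
  qed
  have dim_G: "dim (b ` G) = 1"
  proof -
    have "dim (b ` G) = dim {e}" by (metis spanG dim_span)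
    also have "\<dots> = 1" using e by (auto simp: dim_singleton)
    finally show ?thesis .
  qed
  let ?F = "\<lambda>j. if j \<le> 1 then G else F (j - 1)"
  have "non_splitting_flag b (Suc k) ?F"
    unfolding non_splitting_flag_def
  proof (intro conjI ballI allI impI)
    fix j i assume j: "j \<in> {1..Suc k}" and i: "b i \<in> span (b ` ?F j)"
    show "i \<in> ?F j"
    proof (cases "j = 1")
      case True
      then show ?thesis using i spanG by (simp add: G_def)
    next
      case False
      then have "j - 1 \<in> {1..k}" using j by auto
      then show ?thesis using False i j P_span[of "b i" "F (j - 1)"] flat[of "j - 1" i] by auto
    qed
  next
    fix j assume j: "j \<in> {1..Suc k}"
    show "dim (b ` ?F j) = j"
    proof (cases "j = 1")
      case False
      then have "j - 1 \<in> {1..k}" using j by auto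
      then show ?thesis using False j dim_F[of "j - 1"] by auto
    qed (simp add: dim_G)
  next
    fix j assume j: "j \<in> {1..<Suc k}"
    show "?F j \<subset> ?F (Suc j)"
    proof (cases "j = 1")
      case True
      then have "dim (b ` F 1) = 2" "dim (b ` G) = 1"
        using dim_F[of 1] j dim_G by auto
      then show ?thesis using True G_sub[of 1] j by auto
    next
      case False
      then have "F (j - 1) \<subset> F (Suc (j - 1))"
        by (intro F[unfolded non_splitting_flag_def, THEN conjunct2, THEN conjunct1, rule_format]) (use j in auto)
      then show ?thesis using False j by auto
    qed
  next
    show "sum b (?F 1) \<noteq> 0" using s by (simp add: G_def)
  next
    fix j assume j: "j \<in> {2..Suc k}"
    show "sum b (?F j) \<notin> span (b ` ?F (j - 1))"
    proof
      assume "sum b (?F j) \<in> span (b ` ?F (j - 1))"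
      then have in_span: "sum ?b' (F (j - 1)) \<in> span (?b' ` ?F (j - 1))"
        using P_span[of "sum b (F (j - 1))"] j by (auto simp: P.sum)
      show False
      proof (cases "j = 2")
        case True
        have "span (?b' ` G) \<subseteq> {0}"
          by (rule span_minimal) (auto simp: G_def project_along_eq_0[OF e])
        then show False using in_span True first j by auto
      next
        case False
        then have "j - 1 \<in> {2..k}" "\<not> j - 1 \<le> 1" using j by auto
        then show False using in_span nonsplit[of "j - 1"] by simp
      qed
    qed
  qed
  then show ?thesis unfolding G_def .
qed

text \<open>
  Each pole supplies the first step of a flag, and the contraction satisfies the hypotheses
  again with \<open>k\<close> lowered by one.
\<close>
lemma non_splitting_flag_exists:
  fixes b :: "'n::finite \<Rightarrow> real^'m"
  assumes "\<And>i. b i \<noteq> 0 \<Longrightarrow> b i \<bullet> l \<noteq> 0" and "det (hess b l + \<Psi>) \<noteq> 0"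
    and "k \<le> dim {x. \<Psi> *v x = 0}"
  shows "\<exists>F. non_splitting_flag b k F"
  using assms
proof (induction k arbitrary: b l \<Psi>)
  case 0
  show ?case by (simp add: non_splitting_flag_def)
next
  case (Suc k)
  have singular: "det \<Psi> = 0"
  proof (rule ccontr)
    assume "det \<Psi> \<noteq> 0"
    then have "{x. \<Psi> *v x = 0} = {0}" by (auto simp: det_nonzero_iff_kernel)
    then show False using Suc.prems(3) by simp
  qed
  show ?case
  proof (rule hess_pole[OF Suc.prems(1,2) singular])
    fix e l' Q
    assume *: "norm e = 1" "\<exists>i. b i \<noteq> 0 \<and> b i \<in> span {e}"
      "(\<Sum>i | b i \<in> span {e}. b i) \<noteq> 0" "e \<bullet> l' = 0" "\<And>i. b i \<notin> span {e} \<Longrightarrow> b i \<bullet> l' \<noteq> 0"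
      "Q = hess (\<lambda>i. if b i \<in> span {e} then 0 else b i) l' + \<Psi>"
      "det (Q + dyad e (e - transpose Q *v e)) \<noteq> 0"
    note contr = hess_contraction[OF *(1,4,6,7)]
    have "\<exists>F. non_splitting_flag (project_along e \<circ> b) k F"
    proof (rule Suc.IH[OF _ contr(1)])
      fix i assume "(project_along e \<circ> b) i \<noteq> 0"
      then have "b i \<notin> span {e}" using project_along_eq_0[OF *(1)] by auto
      then show "(project_along e \<circ> b) i \<bullet> l' \<noteq> 0"
        using *(4,5) by (simp add: project_along_def inner_diff_left)
    next
      show "k \<le> dim {x. matrix (\<lambda>y. project_along e (\<Psi> *v project_along e y) + (e \<bullet> y) *\<^sub>R e) *v x = 0}"
        using contr(2) Suc.prems(3) by linarith
    qed
    then show ?case using non_splitting_flag_lift[OF *(1) _ _ *(3)] *(2) by blast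
  qed
qed

section \<open>Kernels of minimal corank\<close>

lemma orthogonal_projection_matrix:
  fixes K :: "(real^'m) set"
  assumes "subspace K"
  obtains Z :: "real^'m^'m" where "\<And>x. Z *v x \<in> K" "\<And>x. x \<in> K \<Longrightarrow> Z *v x = x"
    "\<And>x. Z *v x = 0 \<longleftrightarrow> (\<forall>y\<in>K. orthogonal y x)"
proof -
  obtain U where U: "U \<subseteq> K" "pairwise orthogonal U" "\<And>x. x \<in> U \<Longrightarrow> norm x = 1"
    "independent U" "span U = K"
    using orthonormal_basis_subspace[OF assms] by metis
  have "finite U" using U(4) by (rule independent_imp_finite)
  define g where "g x = (\<Sum>u\<in>U. (u \<bullet> x) *\<^sub>R u)" for x
  have "linear g"
    by (auto intro!: linearI simp: g_def inner_add_right scaleR_add_left sum.distrib scaleR_sum_right)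
  then have Z: "matrix g *v x = g x" for x
    using fun_cong[OF matrix_vector_mul(2)] by blast
  have gK: "g x \<in> K" for x
    using U(1) assms by (auto simp: g_def intro!: subspace_sum subspace_scale)
  have gu: "u \<bullet> g x = u \<bullet> x" if "u \<in> U" for u x
  proof -
    have "u \<bullet> g x = (\<Sum>v\<in>U. (v \<bullet> x) * (u \<bullet> v))" by (simp add: g_def inner_sum_right)
    also have "\<dots> = (\<Sum>v\<in>U. if v = u then u \<bullet> x else 0)"
      using U(2,3) that by (intro sum.cong) (auto simp: pairwise_def orthogonal_def dot_square_norm)
    finally show ?thesis using that \<open>finite U\<close> by simp
  qed
  have gy: "y \<bullet> g x = y \<bullet> x" if "y \<in> K" for x y
  proof -
    have "y \<in> span U" using that U(5) by simp
    then have "y \<bullet> (g x - x) = 0"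
      by (rule span_induct) (auto simp: gu inner_diff_right subspace_def inner_add_left)
    then show ?thesis by (simp add: inner_diff_right)
  qed
  show thesis
  proof (rule that[of "matrix g"])
    show "matrix g *v x \<in> K" for x by (simp add: Z gK)
    show "matrix g *v x = x" if "x \<in> K" for x
    proof -
      have "g x - x \<in> K" using gK that assms by (simp add: subspace_diff)
      then have "(g x - x) \<bullet> (g x - x) = 0" by (simp add: inner_diff_right gy)
      then show ?thesis by (simp add: Z)
    qed
    show "matrix g *v x = 0 \<longleftrightarrow> (\<forall>y\<in>K. orthogonal y x)" for x
      unfolding Z orthogonal_def
    proof
      assume "g x = 0" then show "\<forall>y\<in>K. y \<bullet> x = 0" by (metis gy inner_zero_right)
    next
      assume "\<forall>y\<in>K. y \<bullet> x = 0"
      then show "g x = 0" using gy[OF gK, of x x] gK[of x] by simp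
    qed
  qed
qed

lemma det_add_kernel_projection:
  fixes M Z :: "real^'m^'m"
  assumes sym: "\<And>x y. (M *v x) \<bullet> y = x \<bullet> (M *v y)"
    and Z: "\<And>x. M *v (Z *v x) = 0" "\<And>x. M *v x = 0 \<Longrightarrow> Z *v x = x"
  shows "det (M + Z) \<noteq> 0"
  unfolding det_nonzero_iff_kernel
proof (intro allI impI)
  fix x assume "(M + Z) *v x = 0"
  then have Mx: "M *v x = - (Z *v x)"
    by (simp add: matrix_vector_mult_add_rdistrib eq_neg_iff_add_eq_0)
  have "(M *v x) \<bullet> (M *v x) = x \<bullet> (M *v (M *v x))" by (rule sym)
  also have "\<dots> = - (x \<bullet> (M *v (Z *v x)))"
    using matrix_vector_mult_scaleR[of M "-1" "Z *v x"] by (simp add: Mx)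
  finally have "M *v x = 0" by (simp add: Z)
  then show "x = 0" using Mx Z(2)[of x] by simp
qed

text \<open>
  A kernel whose dimension does not drop moves differentiably.  Adding the projection to the
  kernel at \<open>0\<close> makes the matrix invertible, and Cramer's rule solves
  \<open>(M t + Z) *v w t = u\<close> differentiably.  Such a \<open>w t\<close> lies in the kernel of \<open>M t\<close>:
  the vectors mapped by \<open>M t + Z\<close> into the kernel at \<open>0\<close> contain the kernel of \<open>M t\<close>,
  and their dimension is at most that of the kernel at \<open>0\<close>.
\<close>
lemma kernel_curve:
  fixes M :: "real \<Rightarrow> real^'m^'m"
  assumes sym: "\<And>x y. (M 0 *v x) \<bullet> y = x \<bullet> (M 0 *v y)"
    and diff: "\<And>p q. (\<lambda>t. M t $ p $ q) differentiable (at 0)"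
    and dims: "\<forall>\<^sub>F t in nhds 0. dim {x. M 0 *v x = 0} \<le> dim {x. M t *v x = 0}"
    and u: "M 0 *v u = 0"
  shows "\<exists>w. w 0 = u \<and> (\<forall>k. (\<lambda>t. w t $ k) differentiable (at 0)) \<and>
    (\<forall>\<^sub>F t in nhds 0. M t *v w t = 0 \<and> dim {x. M t *v x = 0} = dim {x. M 0 *v x = 0})"
proof -
  let ?K = "\<lambda>t. {x. M t *v x = 0}"
  obtain Z where Z: "\<And>x. Z *v x \<in> ?K 0" "\<And>x. x \<in> ?K 0 \<Longrightarrow> Z *v x = x"
    by (rule orthogonal_projection_matrix[OF subspace_kernel[of "M 0"]]) (rule that; simp)
  define N where "N t = M t + Z" for t
  define w where "w t = (\<chi> k. det (\<chi> i j. if j = k then u $ i else N t $ i $ j) / det (N t))" for t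
  have det0: "det (N 0) \<noteq> 0"
    unfolding N_def by (rule det_add_kernel_projection[OF sym]) (use Z in auto)
  have Ndiff: "(\<lambda>t. N t $ p $ q) differentiable (at 0)" for p q
    by (simp add: N_def diff)
  have w: "N t *v w t = u" if "det (N t) \<noteq> 0" for t
    unfolding w_def using cramer[OF that] by blast
  have "((\<lambda>t. det (N t)) \<longlongrightarrow> det (N 0)) (nhds 0)"
    using differentiable_imp_continuous_within[OF det_differentiable[OF Ndiff]]
    using tendsto_at_iff_tendsto_nhds[of "\<lambda>t. det (N t)" 0] by (simp add: continuous_within)
  then have "\<forall>\<^sub>F t in nhds 0. det (N t) \<noteq> 0"
    using det0 by (rule tendsto_imp_eventually_ne)
  then have "\<forall>\<^sub>F t in nhds 0. M t *v w t = 0 \<and> dim (?K t) = dim (?K 0)"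
    using dims
  proof eventually_elim
    case (elim t)
    let ?E = "{x. N t *v x \<in> ?K 0}"
    have inj: "inj ((*v) (N t))"
      using elim(1) unfolding det_nonzero_iff_kernel
      by (intro injI) (metis eq_iff_diff_eq_0 matrix_vector_mult_diff_distrib)
    have subE: "subspace ?E"
      using subspace_kernel[of "M 0"]
      by (auto simp: subspace_def matrix_vector_right_distrib matrix_vector_mult_scaleR)
    have "dim ?E = dim ((*v) (N t) ` ?E)"
      using inj by (intro dim_image_eq[symmetric]) (auto intro: inj_on_subset)
    also have "\<dots> \<le> dim (?K 0)" by (rule dim_subset) auto
    finally have E: "dim ?E \<le> dim (?K 0)" .
    \<comment> \<open>On the kernel of \<open>M t\<close> the matrix \<open>N t\<close> agrees with \<open>Z\<close>.\<close>
    have sub: "?K t \<subseteq> ?E"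
      using Z(1) by (auto simp: N_def matrix_vector_mult_add_rdistrib)
    then have "dim (?K t) \<le> dim ?E" by (rule dim_subset)
    then have eq: "?K t = ?E" "dim (?K t) = dim (?K 0)"
      using subspace_dim_equal[OF subspace_kernel subE sub] E elim(2) by auto
    have "w t \<in> ?E" using w[OF elim(1)] u by simp
    then show ?case using eq by blast
  qed
  moreover have "w 0 = u"
  proof -
    have "N 0 *v (w 0 - u) = 0"
      using w[OF det0] u Z(2)[of u]
      by (simp add: matrix_vector_mult_diff_distrib N_def matrix_vector_mult_add_rdistrib)
    then show ?thesis using det0 unfolding det_nonzero_iff_kernel by (metis eq_iff_diff_eq_0)
  qed
  moreover have "(\<lambda>t. w t $ k) differentiable (at 0)" for k
  proof -
    have entries: "(\<lambda>t. (\<chi> i j. if j = k then u $ i else N t $ i $ j) $ p $ q) differentiable (at 0)" for p q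
      by (cases "q = k") (simp_all add: Ndiff)
    show ?thesis
      unfolding w_def vec_lambda_beta
      by (intro differentiable_divide det_differentiable Ndiff det0 entries)
  qed
  ultimately show ?thesis by blast
qed

lemma hess_symmetric: "(hess b l *v x) \<bullet> y = x \<bullet> (hess b l *v y)"
  by (simp add: hess_mult inner_sum_left inner_sum_right inner_commute mult_ac)

text \<open>
  If \<open>b\<close> is the disjoint union of dual-homogeneous parts and the ratio is constant on each of
  them, then \<open>u\<close> lies in the kernel of \<open>hess b l\<close>.  The proof goes the opposite way, from
  the kernel to the parts.
\<close>
definition ratio :: "('n \<Rightarrow> real^'m) \<Rightarrow> real^'m \<Rightarrow> real^'m \<Rightarrow> 'n \<Rightarrow> real" where
  "ratio b l u i = b i \<bullet> u / (b i \<bullet> l)"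

text \<open>
  Used with \<open>D\<close> the minimal dimension of the kernel of \<open>hess b l\<close>: then \<open>l\<close> is a generic
  point and \<open>u\<close> a kernel vector at it.
\<close>
definition corank_attained :: "('n::finite \<Rightarrow> real^'m) \<Rightarrow> nat \<Rightarrow> real^'m \<Rightarrow> real^'m \<Rightarrow> bool" where
  "corank_attained b D l u \<longleftrightarrow>
     (\<forall>i. b i \<bullet> l \<noteq> 0) \<and> dim {x. hess b l *v x = 0} = D \<and> hess b l *v u = 0"

text \<open>
  At a point of minimal corank the dimension of the kernel cannot drop nearby, so every kernel
  vector can be continued in every direction \<open>v\<close>.
\<close>
lemma hess_kernel_curve:
  fixes b :: "'n::finite \<Rightarrow> real^'m"
  assumes minimal: "\<forall>l. (\<forall>i. b i \<bullet> l \<noteq> 0) \<longrightarrow> D \<le> dim {x. hess b l *v x = 0}"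
    and good: "corank_attained b D l u"
  shows "\<exists>w. w 0 = u \<and> (\<forall>k. (\<lambda>t. w t $ k) differentiable (at 0)) \<and>
    (\<forall>\<^sub>F t in nhds 0. corank_attained b D (l + t *\<^sub>R v) (w t))"
proof -
  have ne: "b i \<bullet> l \<noteq> 0" for i using good by (simp add: corank_attained_def)
  have D: "dim {x. hess b l *v x = 0} = D" using good by (simp add: corank_attained_def)
  have ev: "\<forall>\<^sub>F t in nhds 0. \<forall>i. b i \<bullet> (l + t *\<^sub>R v) \<noteq> 0"
  proof (rule eventually_all_finite)
    fix i
    have "((\<lambda>t. b i \<bullet> (l + t *\<^sub>R v)) \<longlongrightarrow> b i \<bullet> (l + 0 *\<^sub>R v)) (nhds 0)"
      by (intro tendsto_intros filterlim_ident)
    then show "\<forall>\<^sub>F t in nhds 0. b i \<bullet> (l + t *\<^sub>R v) \<noteq> 0"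
      by (rule tendsto_imp_eventually_ne) (simp add: ne)
  qed
  let ?M = "\<lambda>t. hess b (l + t *\<^sub>R v)"
  have "\<exists>w. w 0 = u \<and> (\<forall>k. (\<lambda>t. w t $ k) differentiable (at 0)) \<and>
    (\<forall>\<^sub>F t in nhds 0. ?M t *v w t = 0 \<and> dim {x. ?M t *v x = 0} = dim {x. ?M 0 *v x = 0})"
  proof (rule kernel_curve[of ?M u])
    show "(?M 0 *v x) \<bullet> y = x \<bullet> (?M 0 *v y)" for x y by (rule hess_symmetric)
    show "(\<lambda>t. ?M t $ p $ q) differentiable (at 0)" for p q
      using ne by (auto simp: hess_def inner_add_right intro!: derivative_intros)
    show "\<forall>\<^sub>F t in nhds 0. dim {x. ?M 0 *v x = 0} \<le> dim {x. ?M t *v x = 0}"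
      using ev by eventually_elim (simp add: D minimal)
    show "?M 0 *v u = 0" using good by (simp add: corank_attained_def)
  qed
  then obtain w where w: "w 0 = u" "\<And>k. (\<lambda>t. w t $ k) differentiable (at 0)"
    "\<forall>\<^sub>F t in nhds 0. ?M t *v w t = 0 \<and> dim {x. ?M t *v x = 0} = dim {x. ?M 0 *v x = 0}"
    by blast
  from ev w(3) have "\<forall>\<^sub>F t in nhds 0. corank_attained b D (l + t *\<^sub>R v) (w t)"
    by eventually_elim (simp add: corank_attained_def D)
  with w show ?thesis by blast
qed

text \<open>
  This is where the partition into dual-homogeneous parts comes from.  Write
  \<open>q i = ratio b l u i\<close>.  The case \<open>k = 0\<close> is the kernel equation.  For the step,
  differentiate the identity for \<open>k\<close> along a curve through \<open>(l, u)\<close> with direction \<open>v\<close>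
  and take the inner product with \<open>u\<close>.  The derivative \<open>w'\<close> of the kernel vector enters only
  through \<open>(\<Sum>i. q i ^ Suc k *\<^sub>R b i) \<bullet> w'\<close>, which is \<open>0\<close> by induction; what remains is
  the inner product of the next power sum with the arbitrary vector \<open>v\<close>.
\<close>
lemma ratio_power_sums_vanish:
  fixes b :: "'n::finite \<Rightarrow> real^'m"
  assumes minimal: "\<forall>l. (\<forall>i. b i \<bullet> l \<noteq> 0) \<longrightarrow> D \<le> dim {x. hess b l *v x = 0}"
    and "corank_attained b D l u"
  shows "(\<Sum>i\<in>UNIV. ratio b l u i ^ Suc k *\<^sub>R b i) = 0"
  using assms(2)
proof (induction k arbitrary: l u)
  case 0
  then show ?case by (simp add: corank_attained_def hess_mult ratio_def)
next
  case (Suc k)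
  let ?q = "ratio b l u"
  have ne: "b i \<bullet> l \<noteq> 0" for i using Suc.prems by (simp add: corank_attained_def)
  have "(\<Sum>i\<in>UNIV. ?q i ^ Suc (Suc k) *\<^sub>R b i) \<bullet> v = 0" for v
  proof -
    obtain w where w: "w 0 = u" "\<And>k. (\<lambda>t. w t $ k) differentiable (at 0)"
      and ev: "\<forall>\<^sub>F t in nhds 0. corank_attained b D (l + t *\<^sub>R v) (w t)"
      using hess_kernel_curve[OF minimal Suc.prems, of v] by blast
    from w(2) have "\<forall>k. \<exists>d. ((\<lambda>t. w t $ k) has_real_derivative d) (at 0)"
      by (simp add: real_differentiable_def)
    then obtain d where d: "\<And>k. ((\<lambda>t. w t $ k) has_real_derivative d k) (at 0)" by metis
    define w' where "w' = (\<chi> k. d k)"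
    have dw: "((\<lambda>t. b i \<bullet> w t) has_real_derivative b i \<bullet> w') (at 0)" for i
      unfolding inner_vec_def w'_def by (auto intro!: derivative_eq_intros d sum.cong)
    have dl: "((\<lambda>t. b i \<bullet> (l + t *\<^sub>R v)) has_real_derivative b i \<bullet> v) (at 0)" for i
      by (auto simp: inner_add_right intro!: derivative_eq_intros)
    \<comment> \<open>The quotient rule, with the value \<open>ratio b l u i\<close> of the quotient substituted.\<close>
    define f' where "f' i = (b i \<bullet> w' - ?q i * (b i \<bullet> v)) / (b i \<bullet> l)" for i
    have df: "((\<lambda>t. ratio b (l + t *\<^sub>R v) (w t) i) has_real_derivative f' i) (at 0)" for i
      unfolding ratio_def
      by (rule DERIV_cong[OF DERIV_divide[OF dw dl]])
         (use ne in \<open>simp_all add: f'_def w(1) ratio_def field_simps\<close>)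
    let ?g = "\<lambda>t. \<Sum>i\<in>UNIV. ratio b (l + t *\<^sub>R v) (w t) i ^ Suc k * (b i \<bullet> u)"
    have "(?g has_real_derivative (\<Sum>i\<in>UNIV. (real (Suc k) * (f' i * ?q i ^ k)) * (b i \<bullet> u))) (at 0)"
    proof (rule DERIV_sum)
      fix i
      have "((\<lambda>t. ratio b (l + t *\<^sub>R v) (w t) i ^ Suc k) has_real_derivative
          real (Suc k) * (f' i * ?q i ^ k)) (at 0)"
        using DERIV_power_Suc[OF df[of i], of k] by (simp add: w(1) algebra_simps)
      then show "((\<lambda>t. ratio b (l + t *\<^sub>R v) (w t) i ^ Suc k * (b i \<bullet> u)) has_real_derivative
          (real (Suc k) * (f' i * ?q i ^ k)) * (b i \<bullet> u)) (at 0)"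
        by (rule DERIV_cmult_right)
    qed
    moreover have "(?g has_real_derivative 0) (at 0)"
    proof -
      have "\<forall>\<^sub>F t in nhds 0. ?g t = 0"
        using ev
      proof eventually_elim
        case (elim t)
        have "?g t = (\<Sum>i\<in>UNIV. ratio b (l + t *\<^sub>R v) (w t) i ^ Suc k *\<^sub>R b i) \<bullet> u"
          by (simp add: inner_sum_left)
        then show ?case using Suc.IH[OF elim] by simp
      qed
      then show ?thesis using DERIV_cong_ev[of 0 0 ?g "\<lambda>_. 0" 0 0] by simp
    qed
    ultimately have "(\<Sum>i\<in>UNIV. (real (Suc k) * (f' i * ?q i ^ k)) * (b i \<bullet> u)) = 0"
      by (rule DERIV_unique)
    then have "real (Suc k) * (\<Sum>i\<in>UNIV. f' i * ?q i ^ k * (b i \<bullet> u)) = 0"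
      by (simp add: sum_distrib_left mult.assoc)
    then have "(\<Sum>i\<in>UNIV. f' i * ?q i ^ k * (b i \<bullet> u)) = 0" by simp
    moreover have "f' i * ?q i ^ k * (b i \<bullet> u)
        = ?q i ^ Suc k * (b i \<bullet> w') - ?q i ^ Suc (Suc k) * (b i \<bullet> v)" for i
    proof -
      have "b i \<bullet> u = ?q i * (b i \<bullet> l)" using ne by (simp add: ratio_def)
      then have "f' i * ?q i ^ k * (b i \<bullet> u) = (f' i * (b i \<bullet> l)) * ?q i ^ Suc k" by simp
      also have "f' i * (b i \<bullet> l) = b i \<bullet> w' - ?q i * (b i \<bullet> v)"
        using ne by (simp add: f'_def)
      finally show ?thesis by (simp add: algebra_simps)
    qed
    ultimately have "(\<Sum>i\<in>UNIV. ?q i ^ Suc k *\<^sub>R b i) \<bullet> w'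
        - (\<Sum>i\<in>UNIV. ?q i ^ Suc (Suc k) *\<^sub>R b i) \<bullet> v = 0"
      by (simp add: inner_sum_left sum_subtractf)
    then show ?thesis using Suc.IH[OF Suc.prems] by simp
  qed
  then show ?case by (metis inner_eq_zero_iff)
qed

section \<open>The partition by ratios\<close>

text \<open>
  Evaluate the moments on the Lagrange polynomial that vanishes on \<open>C\<close> except at \<open>c\<close>.
\<close>
lemma moments_determine_weights:
  fixes w :: "real \<Rightarrow> 'a::real_vector"
  assumes "finite C" and moments: "\<And>k. (\<Sum>c\<in>C. c ^ k *\<^sub>R w c) = 0" and "c \<in> C"
  shows "w c = 0"
proof -
  have poly: "(\<Sum>c\<in>C. poly p c *\<^sub>R w c) = 0" for p
  proof -
    have "(\<Sum>c\<in>C. poly p c *\<^sub>R w c) = (\<Sum>c\<in>C. \<Sum>i\<le>degree p. coeff p i *\<^sub>R c ^ i *\<^sub>R w c)"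
      by (simp add: poly_altdef scaleR_sum_left)
    also have "\<dots> = (\<Sum>i\<le>degree p. coeff p i *\<^sub>R (\<Sum>c\<in>C. c ^ i *\<^sub>R w c))"
      unfolding scaleR_sum_right by (rule sum.swap)
    finally show ?thesis by (simp add: moments)
  qed
  define p where "p = (\<Prod>d\<in>C - {c}. [:- d, 1:])"
  have p: "poly p x = (\<Prod>d\<in>C - {c}. x - d)" for x by (simp add: p_def poly_prod)
  have "0 = poly p c *\<^sub>R w c + (\<Sum>x\<in>C - {c}. poly p x *\<^sub>R w x)"
    using poly[of p] sum.remove[OF assms(1,3), of "\<lambda>c. poly p c *\<^sub>R w c"] by simp
  also have "(\<Sum>x\<in>C - {c}. poly p x *\<^sub>R w x) = 0"
    using assms(1) by (intro sum.neutral) (auto simp: p)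
  finally have "poly p c = 0 \<or> w c = 0" by simp
  then show ?thesis using assms(1) by (auto simp: p)
qed

text \<open>
  Distinct limits keep the functions distinct nearby, so the level sets can only get finer; if
  the number of values does not grow, they stay the same.
\<close>
lemma level_sets_persist:
  fixes q :: "'n::finite \<Rightarrow> real" and f :: "'n \<Rightarrow> real \<Rightarrow> real"
  assumes lim: "\<And>i. (f i \<longlongrightarrow> q i) F"
    and card: "\<forall>\<^sub>F t in F. card (range (\<lambda>i. f i t)) \<le> card (range q)"
  shows "\<forall>\<^sub>F t in F. \<forall>i j. q i = q j \<longrightarrow> f i t = f j t"
proof -
  have "\<forall>\<^sub>F t in F. \<forall>i j. q i \<noteq> q j \<longrightarrow> f i t \<noteq> f j t"
  proof (intro eventually_all_finite)
    fix i j
    have "((\<lambda>t. f i t - f j t) \<longlongrightarrow> q i - q j) F" by (intro tendsto_intros lim)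
    then show "\<forall>\<^sub>F t in F. q i \<noteq> q j \<longrightarrow> f i t \<noteq> f j t"
      using tendsto_imp_eventually_ne[of "\<lambda>t. f i t - f j t" "q i - q j" F 0]
      by (cases "q i = q j") auto
  qed
  then show ?thesis
    using card
  proof eventually_elim
    case (elim t)
    \<comment> \<open>The map that sends a value at \<open>t\<close> to the limit value; comparing cardinalities shows that it is injective.\<close>
    define h where "h y = q (SOME i. f i t = y)" for y
    have h: "h (f i t) = q i" for i
      unfolding h_def using elim(1) by (metis (mono_tags, lifting) someI)
    then have "h ` range (\<lambda>i. f i t) = range q" by (auto simp: image_image)
    then have "inj_on h (range (\<lambda>i. f i t))"
      using elim(2) card_image_le[of "range (\<lambda>i. f i t)" h]
      by (intro eq_card_imp_inj_on) simp_all
    then show ?case using h by (metis inj_on_def rangeI)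
  qed
qed


lemma dim_independent_subspaces_le:
  fixes S :: "'a \<Rightarrow> ('b::euclidean_space) set"
  assumes "finite C" "subspace T"
    and S: "\<And>c. c \<in> C \<Longrightarrow> subspace (S c)" "\<And>c. c \<in> C \<Longrightarrow> S c \<subseteq> T"
    and indep: "\<And>w c. (\<And>c. c \<in> C \<Longrightarrow> w c \<in> S c) \<Longrightarrow> (\<Sum>c\<in>C. w c) = 0 \<Longrightarrow> c \<in> C \<Longrightarrow> w c = 0"
  shows "(\<Sum>c\<in>C. dim (S c)) \<le> dim T"
proof -
  let ?U = "\<lambda>D. {\<Sum>c\<in>D. w c |w. \<forall>c\<in>D. w c \<in> S c}"
  have "subspace (?U D) \<and> dim (?U D) = (\<Sum>c\<in>D. dim (S c))" if "finite D" "D \<subseteq> C" for D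
    using that
  proof (induction D rule: finite_induct)
    case empty
    then show ?case by (simp add: dim_singleton)
  next
    case (insert d D)
    then have sub: "subspace (?U D)" and dimU: "dim (?U D) = (\<Sum>c\<in>D. dim (S c))"
      and Sd: "subspace (S d)" using S by auto
    have split: "?U (insert d D) = {x + y |x y. x \<in> S d \<and> y \<in> ?U D}"
    proof (intro equalityI subsetI)
      fix z assume "z \<in> ?U (insert d D)"
      then obtain w where "z = w d + (\<Sum>c\<in>D. w c)" "\<forall>c\<in>insert d D. w c \<in> S c"
        using insert.hyps by auto
      then show "z \<in> {x + y |x y. x \<in> S d \<and> y \<in> ?U D}" by blast
    next
      fix z assume "z \<in> {x + y |x y. x \<in> S d \<and> y \<in> ?U D}"
      then obtain x w where z: "z = x + (\<Sum>c\<in>D. w c)" "x \<in> S d" "\<forall>c\<in>D. w c \<in> S c"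
        by blast
      have "(\<Sum>c\<in>D. (w(d := x)) c) = (\<Sum>c\<in>D. w c)"
        using insert.hyps by (intro sum.cong) auto
      then have "z = (\<Sum>c\<in>insert d D. (w(d := x)) c)" using z insert.hyps by simp
      moreover have "\<forall>c\<in>insert d D. (w(d := x)) c \<in> S c" using z by auto
      ultimately show "z \<in> ?U (insert d D)" by blast
    qed
    have "S d \<inter> ?U D \<subseteq> {0}"
    proof
      fix x assume "x \<in> S d \<inter> ?U D"
      then obtain w where x: "x \<in> S d" and w: "x = (\<Sum>c\<in>D. w c)" "\<forall>c\<in>D. w c \<in> S c" by blast
      define w' where "w' c = (if c = d then - x else if c \<in> D then w c else 0)" for c
      have "(\<Sum>c\<in>C. w' c) = (\<Sum>c\<in>insert d D. w' c)"
        using insert.prems \<open>finite C\<close> by (intro sum.mono_neutral_right) (auto simp: w'_def)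
      also have "\<dots> = - x + (\<Sum>c\<in>D. w' c)" using insert.hyps by (simp add: w'_def)
      also have "(\<Sum>c\<in>D. w' c) = x"
        unfolding w(1) using insert.hyps by (intro sum.cong) (auto simp: w'_def)
      finally have 0: "(\<Sum>c\<in>C. w' c) = 0" by simp
      have "w' c \<in> S c" if "c \<in> C" for c
        using that x w(2) S(1)[OF that] by (auto simp: w'_def subspace_neg subspace_0)
      from indep[of w', OF this 0, of d] have "w' d = 0" using insert.prems by auto
      then show "x \<in> {0}" by (simp add: w'_def)
    qed
    then have disj: "dim (S d \<inter> ?U D) = 0" by (simp only: dim_eq_0)
    have "dim (?U (insert d D)) = (\<Sum>c\<in>insert d D. dim (S c))"
      using dim_sums_Int[OF Sd sub] insert.hyps unfolding split disj dimU by simp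
    moreover have "subspace (?U (insert d D))"
      unfolding split by (rule subspace_sums[OF Sd sub])
    ultimately show ?case by blast
  qed
  then have "(\<Sum>c\<in>C. dim (S c)) = dim (?U C)" using \<open>finite C\<close> by simp
  also have "\<dots> \<le> dim T"
    using S(2) \<open>subspace T\<close> by (intro dim_subset) (auto intro!: subspace_sum)
  finally show ?thesis .
qed

text \<open>
  Continue \<open>u\<close> to a kernel vector \<open>z t\<close> at \<open>l + t *\<^sub>R v\<close>.  As the number of values of the ratio is
  maximal, it is still constant on the same parts, so that
  \<open>w c \<bullet> z t = f c t * (w c \<bullet> (l + t *\<^sub>R v)) = t * f c t * (w c \<bullet> v)\<close> with
  \<open>f c t\<close> tending to \<open>c\<close>.  Sum over \<open>c\<close>, divide by \<open>t\<close> and let \<open>t\<close> tend to \<open>0\<close>.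
\<close>
lemma ratio_scales_relations:
  fixes b :: "'n::finite \<Rightarrow> real^'m"
  assumes minimal: "\<forall>l. (\<forall>i. b i \<bullet> l \<noteq> 0) \<longrightarrow> D \<le> dim {x. hess b l *v x = 0}"
    and good: "corank_attained b D l u"
    and finest: "\<forall>l' u'. corank_attained b D l' u' \<longrightarrow>
        card (range (ratio b l' u')) \<le> card (range (ratio b l u))"
    and w: "\<And>c. c \<in> range (ratio b l u) \<Longrightarrow> w c \<in> span (b ` {i. ratio b l u i = c})"
      "\<And>c. c \<in> range (ratio b l u) \<Longrightarrow> w c \<bullet> l = 0"
    and sum: "(\<Sum>c\<in>range (ratio b l u). w c) = 0"
  shows "(\<Sum>c\<in>range (ratio b l u). c *\<^sub>R w c) = 0"
proof -
  let ?q = "ratio b l u"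
  let ?C = "range ?q"
  have "(\<Sum>c\<in>?C. c *\<^sub>R w c) \<bullet> v = 0" for v
  proof -
    obtain z where z: "z 0 = u" "\<And>k. (\<lambda>t. z t $ k) differentiable (at 0)"
      and ev: "\<forall>\<^sub>F t in nhds 0. corank_attained b D (l + t *\<^sub>R v) (z t)"
      using hess_kernel_curve[OF minimal good, of v] by blast
    let ?f = "\<lambda>i t. ratio b (l + t *\<^sub>R v) (z t) i"
    have ne: "b i \<bullet> l \<noteq> 0" for i using good by (simp add: corank_attained_def)
    have ev': "\<forall>\<^sub>F t in at 0. corank_attained b D (l + t *\<^sub>R v) (z t)"
      using ev by (simp add: eventually_at_filter eventually_mono)
    have lim: "(?f i \<longlongrightarrow> ?q i) (at 0)" for i
    proof -
      have "((\<lambda>t. z t $ k) \<longlongrightarrow> u $ k) (at 0)" for k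
        using differentiable_imp_continuous_within[OF z(2)[of k]] z(1)
        by (simp add: continuous_within)
      then have "(z \<longlongrightarrow> u) (at 0)" by (rule vec_tendstoI)
      then have "(?f i \<longlongrightarrow> b i \<bullet> u / (b i \<bullet> (l + 0 *\<^sub>R v))) (at 0)"
        unfolding ratio_def by (intro tendsto_intros) (simp_all add: ne)
      then show ?thesis by (simp add: ratio_def)
    qed
    have "\<forall>\<^sub>F t in at 0. \<forall>i j. ?q i = ?q j \<longrightarrow> ?f i t = ?f j t"
      by (rule level_sets_persist[OF lim]) (use ev' finest in \<open>auto elim: eventually_mono\<close>)
    moreover have "\<forall>\<^sub>F t in at 0. t \<noteq> (0::real)" by (simp add: eventually_at_filter)
    ultimately have zero: "\<forall>\<^sub>F t in at 0. (\<Sum>c\<in>?C. ?f (inv ?q c) t * (w c \<bullet> v)) = 0"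
      using ev'
    proof eventually_elim
      case (elim t)
      let ?l = "l + t *\<^sub>R v"
      have wz: "w c \<bullet> z t = ?f (inv ?q c) t * (t * (w c \<bullet> v))" if "c \<in> ?C" for c
      proof -
        have q: "?q (inv ?q c) = c" using that by (rule f_inv_into_f)
        have "x \<bullet> z t = ?f (inv ?q c) t * (x \<bullet> ?l)" if "x \<in> span (b ` {i. ?q i = c})" for x
          using that
        proof (rule span_induct)
          show "subspace {x. x \<bullet> z t = ?f (inv ?q c) t * (x \<bullet> ?l)}"
            by (auto simp: subspace_def inner_add_left algebra_simps)
        next
          fix x assume "x \<in> b ` {i. ?q i = c}"
          then obtain i where i: "x = b i" "?q i = c" by auto
          then have "?f i t = ?f (inv ?q c) t" using elim(1) q by metis
          moreover have "b i \<bullet> ?l \<noteq> 0" using elim(3) by (simp add: corank_attained_def)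
          then have "b i \<bullet> z t = ?f i t * (b i \<bullet> ?l)" by (simp add: ratio_def)
          ultimately show "x \<bullet> z t = ?f (inv ?q c) t * (x \<bullet> ?l)" by (simp add: i)
        qed
        from this[OF w(1)[OF that]] show ?thesis
          using w(2)[OF that] by (simp add: inner_add_right)
      qed
      have "t * (\<Sum>c\<in>?C. ?f (inv ?q c) t * (w c \<bullet> v)) = (\<Sum>c\<in>?C. w c) \<bullet> z t"
        by (simp add: sum_distrib_left inner_sum_left wz mult_ac del: sum.image_eq cong: sum.cong)
      then show ?case using elim(2) sum by simp
    qed
    have "((\<lambda>t. \<Sum>c\<in>?C. ?f (inv ?q c) t * (w c \<bullet> v)) \<longlongrightarrow>
        (\<Sum>c\<in>?C. ?q (inv ?q c) * (w c \<bullet> v))) (at 0)"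
      by (intro tendsto_intros lim)
    moreover have "((\<lambda>t. \<Sum>c\<in>?C. ?f (inv ?q c) t * (w c \<bullet> v)) \<longlongrightarrow> 0) (at 0)"
      by (rule tendsto_eventually[OF zero])
    ultimately have "(\<Sum>c\<in>?C. ?q (inv ?q c) * (w c \<bullet> v)) = 0"
      using tendsto_unique[OF trivial_limit_at] by blast
    then show ?thesis by (simp add: inner_sum_left f_inv_into_f cong: sum.cong)
  qed
  then show ?thesis by (metis inner_eq_zero_iff)
qed

text \<open>
  Otherwise \<open>u + t *\<^sub>R u'\<close> with a small \<open>t\<close> would have more values of the ratio than \<open>u\<close>.
\<close>
lemma ratio_constant_on_level_sets:
  fixes b :: "'n::finite \<Rightarrow> real^'m"
  assumes good: "corank_attained b D l u"
    and finest: "\<forall>l' u'. corank_attained b D l' u' \<longrightarrow>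
        card (range (ratio b l' u')) \<le> card (range (ratio b l u))"
    and u': "hess b l *v u' = 0" and eq: "ratio b l u i = ratio b l u j"
  shows "ratio b l u' i = ratio b l u' j"
proof -
  have r: "ratio b l (u + t *\<^sub>R u') k = ratio b l u k + t * ratio b l u' k" for t k
    by (simp add: ratio_def inner_add_right add_divide_distrib)
  have "\<forall>\<^sub>F t in at 0. \<forall>i j. ratio b l u i = ratio b l u j \<longrightarrow>
      ratio b l (u + t *\<^sub>R u') i = ratio b l (u + t *\<^sub>R u') j"
  proof (rule level_sets_persist)
    fix i
    have "((\<lambda>t. ratio b l u i + t * ratio b l u' i) \<longlongrightarrow> ratio b l u i + 0 * ratio b l u' i) (at 0)"
      by (intro tendsto_intros)
    then show "((\<lambda>t. ratio b l (u + t *\<^sub>R u') i) \<longlongrightarrow> ratio b l u i) (at 0)" by (simp add: r)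
  next
    have "corank_attained b D l (u + t *\<^sub>R u')" for t
      using good u'
      by (simp add: corank_attained_def matrix_vector_right_distrib matrix_vector_mult_scaleR)
    then show "\<forall>\<^sub>F t in at 0. card (range (\<lambda>i. ratio b l (u + t *\<^sub>R u') i)) \<le> card (range (ratio b l u))"
      using finest by simp
  qed
  moreover have "\<forall>\<^sub>F t in at 0. t \<noteq> (0::real)" by (simp add: eventually_at_filter)
  ultimately have "\<forall>\<^sub>F t in at (0::real). ratio b l u' i = ratio b l u' j"
  proof eventually_elim
    case (elim t)
    then have "ratio b l u i + t * ratio b l u' i = ratio b l u j + t * ratio b l u' j"
      unfolding r[symmetric] using eq by blast
    then show ?case using eq elim(2) by simp
  qed
  then show ?thesis by simp
qed

text \<open>
  Among all \<open>l\<close> of minimal corank \<open>D\<close> and kernel vectors \<open>u\<close> take a pair with the largest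
  number of values of the ratio, and the partition into the level sets of the ratio.  The parts have sum zero
  by the power sum identities.  Inside the span of each part consider the subspace orthogonal
  to \<open>l\<close>, of codimension one.  These subspaces are orthogonal to the kernel, and they are
  independent, since by \<open>ratio_scales_relations\<close> a relation between them can be multiplied by
  every power of the ratio.  Hence their dimensions add up to at most \<open>m - D\<close>, which is also
  the length of the flag that belongs to the projection to the kernel.
\<close>
theorem non_splitting_flag_matching_partition:
  fixes b :: "'n::finite \<Rightarrow> real^'m"
  assumes nonzero: "\<And>i. b i \<noteq> 0" and homogeneous: "(\<Sum>i\<in>UNIV. b i) = 0"
  obtains q :: "'n \<Rightarrow> real" and F k where
    "\<And>c. (\<Sum>i | q i = c. b i) = 0" "non_splitting_flag b k F"
    "(\<Sum>c\<in>range q. dim (b ` {i. q i = c})) \<le> k + card (range q)"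
proof -
  let ?nd = "\<lambda>l. \<forall>i. b i \<bullet> l \<noteq> 0"
  let ?cork = "\<lambda>l. dim {x. hess b l *v x = 0}"
  have "\<exists>l. \<forall>a\<in>range b. a \<bullet> l \<noteq> 0"
    by (rule inner_nonzero_on_finite_set) (use nonzero in \<open>auto simp: image_iff dest: sym\<close>)
  then obtain l1 where "?nd l1" by auto
  then have "\<exists>l. ?nd l \<and> (\<forall>l'. ?nd l' \<longrightarrow> ?cork l \<le> ?cork l')"
    by (rule ex_has_least_nat)
  then obtain l0 where l0: "?nd l0" "\<And>l'. ?nd l' \<Longrightarrow> ?cork l0 \<le> ?cork l'" by blast
  define D where "D = ?cork l0"
  have minimal: "\<forall>l. ?nd l \<longrightarrow> D \<le> ?cork l"
    using l0(2) by (simp add: D_def)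
  let ?P = "\<lambda>p. corank_attained b D (fst p) (snd p)"
  have "?P (l0, 0)" using l0(1) by (simp add: corank_attained_def D_def)
  then have "\<exists>p. ?P p \<and> (\<forall>p'. ?P p' \<longrightarrow>
      card (range (ratio b (fst p') (snd p'))) \<le> card (range (ratio b (fst p) (snd p))))"
    by (rule ex_has_greatest_nat[of _ _ _ "Suc CARD('n)"])
       (metis card_image_le finite_class.finite_UNIV le_imp_less_Suc)
  then obtain l u where good: "corank_attained b D l u"
    and finest: "\<forall>l' u'. corank_attained b D l' u' \<longrightarrow>
        card (range (ratio b l' u')) \<le> card (range (ratio b l u))"
    by auto
  define q where "q = ratio b l u"
  let ?C = "range q"
  let ?S = "\<lambda>c. span (b ` {i. q i = c}) \<inter> {x. l \<bullet> x = 0}"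
  let ?K = "{x. hess b l *v x = 0}"
  have ne: "b i \<bullet> l \<noteq> 0" for i using good by (simp add: corank_attained_def)
  have l_ne: "l \<noteq> 0" using ne[of undefined] by auto
  have K: "dim ?K = D" using good by (simp add: corank_attained_def)
  have parts: "(\<Sum>i | q i = c. b i) = 0" for c
  proof (cases "c \<in> ?C")
    case True
    show ?thesis
    proof (rule moments_determine_weights[of ?C "\<lambda>c. \<Sum>i | q i = c. b i"])
      fix k
      have "(\<Sum>c\<in>?C. c ^ k *\<^sub>R (\<Sum>i | q i = c. b i)) = (\<Sum>c\<in>?C. \<Sum>i | i \<in> UNIV \<and> q i = c. q i ^ k *\<^sub>R b i)"
        by (simp add: scaleR_sum_right)
      also have "\<dots> = (\<Sum>i\<in>UNIV. q i ^ k *\<^sub>R b i)"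
        by (rule sum.group) auto
      also have "\<dots> = 0"
        using homogeneous ratio_power_sums_vanish[OF minimal good]
        by (cases k) (auto simp: q_def)
      finally show "(\<Sum>c\<in>?C. c ^ k *\<^sub>R (\<Sum>i | q i = c. b i)) = 0" .
    qed (use True in auto)
  next
    case False
    then have "{i. q i = c} = {}" by auto
    then show ?thesis by simp
  qed
  have "(\<Sum>c\<in>?C. dim (?S c)) \<le> dim {y \<in> UNIV. \<forall>x\<in>?K. orthogonal x y}"
  proof (rule dim_independent_subspaces_le)
    show "subspace {y \<in> UNIV. \<forall>x\<in>?K. orthogonal x y}"
      by (auto simp: subspace_def orthogonal_def inner_add_right)
    show "subspace (?S c)" for c
      by (intro subspace_inter subspace_span subspace_hyperplane)
    show "?S c \<subseteq> {y \<in> UNIV. \<forall>x\<in>?K. orthogonal x y}" if "c \<in> ?C" for c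
    proof -
      have "orthogonal x y" if x: "x \<in> ?K" and y: "y \<in> span (b ` {i. q i = c})" "l \<bullet> y = 0" for x y
      proof -
        obtain j where j: "q j = c" using \<open>c \<in> ?C\<close> by auto
        have "y \<bullet> x = ratio b l x j * (y \<bullet> l)"
          using y(1)
        proof (rule span_induct)
          show "subspace {y. y \<bullet> x = ratio b l x j * (y \<bullet> l)}"
            by (auto simp: subspace_def inner_add_left algebra_simps)
        next
          fix y assume "y \<in> b ` {i. q i = c}"
          then obtain i where i: "y = b i" "q i = q j" using j by auto
          then have "ratio b l x i = ratio b l x j"
            using ratio_constant_on_level_sets[OF good finest, of x i j] x by (simp add: q_def)
          moreover have "b i \<bullet> x = ratio b l x i * (b i \<bullet> l)" using ne by (simp add: ratio_def)
          ultimately show "y \<bullet> x = ratio b l x j * (y \<bullet> l)" by (simp add: i)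
        qed
        then show ?thesis using y(2) by (simp add: orthogonal_def inner_commute)
      qed
      then show ?thesis by blast
    qed
    fix w c assume w: "\<And>c. c \<in> ?C \<Longrightarrow> w c \<in> ?S c" "(\<Sum>c\<in>?C. w c) = 0" and c: "c \<in> ?C"
    have "(\<Sum>c\<in>?C. c ^ k *\<^sub>R w c) = 0" for k
    proof (induction k)
      case (Suc k)
      have "(\<Sum>c\<in>?C. c *\<^sub>R (c ^ k *\<^sub>R w c)) = 0"
        unfolding q_def
      proof (rule ratio_scales_relations[OF minimal good finest])
        fix c assume "c \<in> range (ratio b l u)"
        then have "w c \<in> ?S c" using w(1) by (simp add: q_def)
        then show "c ^ k *\<^sub>R w c \<in> span (b ` {i. ratio b l u i = c})" "(c ^ k *\<^sub>R w c) \<bullet> l = 0"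
          by (auto simp: q_def span_mul inner_commute)
      qed (use Suc.IH in \<open>auto simp: q_def\<close>)
      then show ?case by simp
    qed (simp add: w(2))
    then show "w c = 0" using c by (intro moments_determine_weights[of ?C w c]) auto
  qed auto
  also have "\<dots> = CARD('m) - D"
    using dim_subspace_orthogonal_to_vectors[OF subspace_kernel[of "hess b l"] subspace_UNIV] K by simp
  finally have dims: "(\<Sum>c\<in>?C. dim (?S c)) \<le> CARD('m) - D" .
  have cut: "dim (b ` {i. q i = c}) \<le> dim (?S c) + 1" for c
  proof -
    let ?V = "span (b ` {i. q i = c})"
    have "dim {x + y |x y. x \<in> ?V \<and> y \<in> {x. l \<bullet> x = 0}} + dim (?S c) = dim ?V + dim {x. l \<bullet> x = 0}"
      by (rule dim_sums_Int[OF subspace_span subspace_hyperplane])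
    moreover have "dim {x + y |x y. x \<in> ?V \<and> y \<in> {x. l \<bullet> x = 0}} \<le> CARD('m)"
      using dim_subset_UNIV[of "{x + y |x y. x \<in> ?V \<and> y \<in> {x. l \<bullet> x = 0}}"] by simp
    ultimately show ?thesis using dim_hyperplane[OF l_ne] by simp
  qed
  obtain Z where Z: "\<And>x. Z *v x \<in> ?K" "\<And>x. x \<in> ?K \<Longrightarrow> Z *v x = x"
    "\<And>x. Z *v x = 0 \<longleftrightarrow> (\<forall>y\<in>?K. orthogonal y x)"
    by (rule orthogonal_projection_matrix[OF subspace_kernel[of "hess b l"]]) (rule that; simp)
  have "\<exists>F. non_splitting_flag b (CARD('m) - D) F"
  proof (rule non_splitting_flag_exists)
    show "b i \<bullet> l \<noteq> 0" for i by (rule ne)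
    show "det (hess b l + Z) \<noteq> 0"
      by (rule det_add_kernel_projection[OF hess_symmetric]) (use Z in auto)
    have "{x. Z *v x = 0} = {y \<in> UNIV. \<forall>x\<in>?K. orthogonal x y}" by (simp add: Z(3))
    then show "CARD('m) - D \<le> dim {x. Z *v x = 0}"
      using dim_subspace_orthogonal_to_vectors[OF subspace_kernel[of "hess b l"] subspace_UNIV] K by simp
  qed
  then obtain F where F: "non_splitting_flag b (CARD('m) - D) F" ..
  have "(\<Sum>c\<in>?C. dim (b ` {i. q i = c})) \<le> (\<Sum>c\<in>?C. dim (?S c) + 1)"
    by (rule sum_mono) (rule cut)
  also have "\<dots> = (\<Sum>c\<in>?C. dim (?S c)) + card ?C" by (simp only: sum.distrib) simp
  also have "\<dots> \<le> CARD('m) - D + card ?C" using dims by simp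
  finally show thesis by (rule that[OF parts F])
qed

section \<open>From real to rational configurations\<close>

definition real_vec :: "rat^'m \<Rightarrow> real^'m" where
  "real_vec x = (\<chi> p. of_rat (x $ p))"

lemma real_vec_simps [simp]:
  "real_vec (x + y) = real_vec x + real_vec y" "real_vec (c *s x) = of_rat c *\<^sub>R real_vec x"
  "real_vec 0 = 0" "real_vec x = real_vec y \<longleftrightarrow> x = y"
  by (auto simp: real_vec_def vec_eq_iff of_rat_add of_rat_mult)

lemma real_vec_eq_0 [simp]: "real_vec x = 0 \<longleftrightarrow> x = 0"
  using real_vec_simps(4)[of x 0] by simp

lemma real_vec_sum: "real_vec (\<Sum>i\<in>I. f i) = (\<Sum>i\<in>I. real_vec (f i))"
  by (induction I rule: infinite_finite_induct) auto

lemma real_vec_span: "x \<in> vec.span S \<Longrightarrow> real_vec x \<in> span (real_vec ` S)"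
proof (induction rule: vec.span_induct)
  case (step x)
  then show ?case by (intro span_base imageI)
next
  case base
  show ?case
    unfolding vec.subspace_def by (auto simp: span_zero span_add span_mul)
qed

text \<open>
  Extend to a basis of the rational space.  Its image spans the real space and has no more
  elements than the dimension, so it is independent.
\<close>
lemma independent_real_vec:
  fixes S :: "(rat^'m) set"
  assumes "vec.independent S"
  shows "independent (real_vec ` S)"
proof -
  obtain W where W: "S \<subseteq> W" "vec.independent W" "UNIV \<subseteq> vec.span W"
    using vec.maximal_independent_subset_extend[OF subset_UNIV assms] by auto
  then have card: "finite W" "card W = CARD('m)"
    using vec.finiteI_independent vec.basis_card_eq_dim[OF subset_UNIV W(3,2)] by (auto simp: card_cart_basis)
  have "axis p 1 \<in> span (real_vec ` W)" for p :: 'm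
  proof -
    have "real_vec (axis p 1) = axis p 1" by (simp add: real_vec_def vec_eq_iff axis_def)
    then show ?thesis using real_vec_span[of "axis p 1" W] W(3) by auto
  qed
  then have "(Basis :: (real^'m) set) \<subseteq> span (real_vec ` W)"
    by (auto simp: Basis_vec_def)
  then have "UNIV \<subseteq> span (real_vec ` W)"
    using span_minimal[OF _ subspace_span] span_Basis by blast
  then have "independent (real_vec ` W)"
    using card card_image_le[of W real_vec]
    by (intro card_le_dim_spanning[of _ UNIV]) auto
  then show ?thesis by (rule independent_mono) (use W(1) in auto)
qed

lemma dim_real_vec: "dim (real_vec ` S) = vec.dim S"
proof -
  obtain U where U: "U \<subseteq> S" "vec.independent U" "S \<subseteq> vec.span U" "card U = vec.dim S"
    by (rule vec.basis_exists)
  show ?thesis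
  proof (rule dim_unique)
    show "real_vec ` U \<subseteq> real_vec ` S" using U(1) by auto
    show "real_vec ` S \<subseteq> span (real_vec ` U)" using U(3) real_vec_span by auto
    show "independent (real_vec ` U)" by (rule independent_real_vec[OF U(2)])
    show "card (real_vec ` U) = vec.dim S" by (simp add: U(4)[symmetric] card_image inj_on_def)
  qed
qed

lemma real_vec_in_span_iff: "real_vec x \<in> span (real_vec ` S) \<longleftrightarrow> x \<in> vec.span S"
proof
  assume *: "real_vec x \<in> span (real_vec ` S)"
  show "x \<in> vec.span S"
  proof (rule ccontr)
    assume "x \<notin> vec.span S"
    then have "dim (real_vec ` insert x S) = vec.dim S + 1"
      unfolding dim_real_vec by (simp add: vec.dim_insert)
    moreover have "dim (real_vec ` insert x S) = vec.dim S"
      using * by (simp add: dim_insert dim_real_vec)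
    ultimately show False by simp
  qed
qed (rule real_vec_span)

lemma flag_of_non_splitting_flag:
  fixes B :: "rat^'m^'n"
  assumes "non_splitting_flag (\<lambda>i. real_vec (B $ i)) k F"
  shows "flag B k F" "non_splitting B k F"
proof -
  have im: "(\<lambda>i. real_vec (B $ i)) ` C = real_vec ` (\<lambda>i. B $ i) ` C" for C
    by (simp add: image_image)
  note * = assms[unfolded non_splitting_flag_def im real_vec_in_span_iff dim_real_vec real_vec_sum[symmetric] real_vec_eq_0]
  show "flag B k F"
    using * unfolding flag_def flat_def dim_L_eq L_def by blast
  show "non_splitting B k F"
    using * unfolding non_splitting_def vsum_def L_def by blast
qed

section \<open>The extremal values\<close>

lemma theta_upper:
  fixes B :: "rat^'m^'n"
  assumes "cayley_decomposition B r P"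
  shows "int r - cayley_defect B r P \<le> theta B"
  unfolding theta_def
proof (rule Max_ge)
  \<comment> \<open>A crude bound for the values, so that the maximum is taken over a finite set.\<close>
  let ?b = "int (CARD('n) * CARD('m) + CARD('n) + CARD('m))"
  have "int s - cayley_defect B s Q \<in> {- ?b..?b}" if Q: "cayley_decomposition B s Q" for s Q
  proof -
    have "Suc s = (\<Sum>j\<le>s. 1)" by simp
    also have "\<dots> \<le> (\<Sum>j\<le>s. card (Q j))"
      using Q by (intro sum_mono) (auto simp: cayley_decomposition_def Suc_le_eq card_gt_0_iff)
    also have "\<dots> = card (\<Union>j\<le>s. Q j)"
      using Q by (intro card_UN_disjoint[symmetric])
        (auto simp: cayley_decomposition_def disjoint_family_on_def)
    also have "\<dots> = CARD('n)" using Q by (simp add: cayley_decomposition_def)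
    finally have s: "Suc s \<le> CARD('n)" .
    have "(\<Sum>j\<le>s. dim_L B (Q j)) \<le> Suc s * CARD('m)"
      using sum_bounded_above[of "{..s}" "\<lambda>j. dim_L B (Q j)" "CARD('m)"] dim_L_le_card[of B] by simp
    also have "\<dots> \<le> CARD('n) * CARD('m)" using s by (rule mult_le_mono1)
    finally have "int (\<Sum>j\<le>s. dim_L B (Q j)) \<le> int (CARD('n) * CARD('m))" by linarith
    then show ?thesis
      using s dim_L_le_card[of B UNIV] sum_nonneg[of "{..s}" "\<lambda>j. int (dim_L B (Q j))"]
      unfolding cayley_defect_def by simp
  qed
  then have "{int s - cayley_defect B s Q |s Q. cayley_decomposition B s Q} \<subseteq> {- ?b..?b}" by blast
  then show "finite {int s - cayley_defect B s Q |s Q. cayley_decomposition B s Q}"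
    by (rule finite_subset) simp
qed (use assms in blast)

lemma finite_flag_lengths:
  fixes B :: "rat^'m^'n"
  shows "finite {l. \<exists>F. flag B l F \<and> non_splitting B l F}"
proof -
  have "l \<le> CARD('m)" if "flag B l F" for l F
  proof (cases "l = 0")
    case False
    then have "dim_L B (F l) = l" using that by (simp add: flag_def)
    then show ?thesis using dim_L_le_card[of B "F l"] by simp
  qed simp
  then have "{l. \<exists>F. flag B l F \<and> non_splitting B l F} \<subseteq> {..CARD('m)}" by auto
  then show ?thesis by (rule finite_subset) simp
qed

lemma lambda_upper: "flag B l F \<Longrightarrow> non_splitting B l F \<Longrightarrow> l \<le> lambda B"
  unfolding lambda_def by (rule Max_ge[OF finite_flag_lengths]) blast

lemma lambda_attained: "\<exists>F. flag B (lambda B) F \<and> non_splitting B (lambda B) F"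
proof -
  have "flag B 0 F" "non_splitting B 0 F" for F
    by (auto simp: flag_def non_splitting_def)
  then have "{l. \<exists>F. flag B l F \<and> non_splitting B l F} \<noteq> {}" by blast
  from Max_in[OF finite_flag_lengths this] show ?thesis unfolding lambda_def by blast
qed

lemma sum_dim_L_minus_1:
  "(\<Sum>j\<le>r. int (dim_L B (P j)) - 1) = int (dim_L B UNIV) - 1 - (int r - cayley_defect B r P)"
  by (simp add: cayley_defect_def sum_subtractf)

text \<open>
  The level sets found over the reals only involve sums and dimensions of spans, which are the same
  over the rationals.
\<close>
lemma cayley_decomposition_matching_lambda:
  fixes B :: "rat^'m^'n"
  assumes nonzero: "\<And>i. B $ i \<noteq> 0" and homogeneous: "(\<Sum>i\<in>UNIV. B $ i) = 0"
  obtains r P where "cayley_decomposition B r P"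
    "(\<Sum>j\<le>r. int (dim_L B (P j)) - 1) \<le> int (lambda B)"
proof -
  let ?b = "\<lambda>i. real_vec (B $ i)"
  have 1: "?b i \<noteq> 0" for i using nonzero by simp
  have 2: "(\<Sum>i\<in>UNIV. ?b i) = 0" by (simp add: real_vec_sum[symmetric] homogeneous)
  show thesis
  proof (rule non_splitting_flag_matching_partition[of ?b, OF 1 2])
    fix q :: "'n \<Rightarrow> real" and F k
    assume zero: "\<And>c. (\<Sum>i | q i = c. ?b i) = 0" and F: "non_splitting_flag ?b k F"
      and dims: "(\<Sum>c\<in>range q. dim (?b ` {i. q i = c})) \<le> k + card (range q)"
    define r where "r = card (range q) - 1"
    have card: "card (range q) = Suc r" by (simp add: r_def card_gt_0_iff)
    then obtain h where h: "bij_betw h {..r} (range q)"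
      using ex_bij_betw_nat_finite[of "range q"] by (auto simp: lessThan_Suc_atMost[symmetric] lessThan_atLeast0)
    define P where "P j = {i. q i = h j}" for j
    have "cayley_decomposition B r P"
      unfolding cayley_decomposition_def
    proof (intro conjI allI impI)
      show "disjoint_family_on P {..r}"
        using h by (auto simp: disjoint_family_on_def P_def bij_betw_def inj_on_def)
      show "(\<Union>j\<le>r. P j) = UNIV"
      proof -
        have "\<exists>j\<le>r. q i = h j" for i
          using bij_betw_imp_surj_on[OF h] by (metis (no_types, lifting) atMost_iff imageE rangeI)
        then show ?thesis by (auto simp: P_def)
      qed
      fix j assume "j \<le> r"
      then have "h j \<in> range q" using h by (auto simp: bij_betw_def)
      then show "P j \<noteq> {}" by (auto simp: P_def)
      show "dual_homogeneous B (P j)"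
        using zero[of "h j"] by (simp add: dual_homogeneous_def vsum_def P_def real_vec_sum[symmetric])
    qed
    moreover have "(\<Sum>j\<le>r. int (dim_L B (P j)) - 1) \<le> int (lambda B)"
    proof -
      have "dim_L B (P j) = dim (?b ` {i. q i = h j})" for j
        unfolding dim_L_eq P_def dim_real_vec[symmetric] by (simp add: image_image)
      then have "(\<Sum>j\<le>r. dim_L B (P j)) = (\<Sum>c\<in>range q. dim (?b ` {i. q i = c}))"
        using sum.reindex_bij_betw[OF h, of "\<lambda>c. dim (?b ` {i. q i = c})"] by simp
      then have "(\<Sum>j\<le>r. dim_L B (P j)) \<le> k + Suc r" using dims card by simp
      then have "(\<Sum>j\<le>r. int (dim_L B (P j))) \<le> int k + int (Suc r)"
        by (metis of_nat_add of_nat_mono of_nat_sum)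
      then have "(\<Sum>j\<le>r. int (dim_L B (P j)) - 1) \<le> int k" by (simp add: sum_subtractf)
      also have "k \<le> lambda B"
        using flag_of_non_splitting_flag[OF F] by (rule lambda_upper)
      finally show ?thesis by simp
    qed
    ultimately show thesis by (rule that)
  qed
qed

section \<open>Gale duals\<close>

text \<open>
  If the \<open>i\<close>-th row vanishes, then so does the \<open>i\<close>-th coordinate on the kernel of the
  matrix.  A functional that vanishes on the kernel factors through the matrix, here as
  \<open>u\<close>; it is \<open>1\<close> at the \<open>i\<close>-th point and \<open>0\<close> at all others.
\<close>
lemma gale_dual_row_nonzero:
  fixes A :: "int^'n^'k" and B :: "rat^'m^'n"
  assumes "\<not> pyramid A" "gale_dual A B"
  shows "B $ i \<noteq> 0"
proof
  assume 0: "B $ i = 0"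
  let ?A = "rat_matrix A"
  have ker: "x $ i = 0" if "?A *v x = 0" for x
  proof -
    have "x \<in> vec.span (columns B)" using that assms(2) by (simp add: gale_dual_def)
    then show ?thesis
      by (rule vec.span_induct) (auto simp: vec.subspace_def columns_def column_def 0)
  qed
  obtain S where S: "Vector_Spaces.linear (*s) (*s) S" "\<And>y. ?A *v S (?A *v y) = ?A *v y"
    using vec.linear_exists_right_inverse_on[OF matrix_vector_mul_linear_gen vec.subspace_UNIV, of ?A]
    by auto
  define u where "u = matrix S $ i"
  have basis: "(?A *v axis j 1) $ k = ?A $ k $ j" for j k
    by (simp add: matrix_vector_mult_def axis_def if_distrib cong: if_cong)
  have u: "(\<Sum>k\<in>UNIV. u $ k * ?A $ k $ j) = (if j = i then 1 else 0)" for j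
  proof -
    have "(\<Sum>k\<in>UNIV. u $ k * ?A $ k $ j) = (matrix S *v (?A *v axis j 1)) $ i"
      by (simp add: u_def matrix_vector_mult_def[of "matrix S"] basis)
    also have "\<dots> = S (?A *v axis j 1) $ i" by (simp add: matrix_works[OF S(1)])
    also have "\<dots> = axis j 1 $ i"
      using ker[of "S (?A *v axis j 1) - axis j 1"] by (simp add: matrix_vector_mult_diff_distrib S(2))
    finally show ?thesis by (auto simp: axis_def)
  qed
  have "u \<noteq> 0"
  proof
    assume "u = 0"
    then show False using u[of i] by simp
  qed
  then have "pyramid A"
    unfolding pyramid_def by (intro exI[of _ i] exI[of _ u] exI[of _ 0]) (use u in auto)
  then show False using assms(1) by blast
qed

lemma gale_dual_rows_sum:
  fixes A :: "int^'n^'k" and B :: "rat^'m^'n"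
  assumes "\<forall>i. column i A $ k0 = 1" "gale_dual A B"
  shows "(\<Sum>i\<in>UNIV. B $ i) = 0"
proof -
  have "(\<Sum>i\<in>UNIV. B $ i) $ j = 0" for j
  proof -
    have "column j B \<in> vec.span (columns B)"
      by (intro vec.span_base) (auto simp: columns_def)
    then have "(rat_matrix A *v column j B) $ k0 = 0" using assms(2) by (simp add: gale_dual_def)
    moreover have "A $ k0 $ i = 1" for i using assms(1) by (simp add: column_def)
    ultimately show ?thesis by (simp add: matrix_vector_mult_def column_def)
  qed
  then show ?thesis by (simp add: vec_eq_iff)
qed

text \<open>
  Among all Cayley decompositions the \<open>\<theta>\<close>-decompositions have the smallest sum, in
  particular one that is at most the sum of the decomposition matching \<open>lambda B\<close>.
\<close>
theorem theorem4p16: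
  fixes A :: "int^'n^'k" and k0 :: 'k and B :: "rat^'m^'n"
    and r :: nat and P :: "nat \<Rightarrow> 'n set"
  assumes "homogeneous A"
    and "\<not> pyramid A"
    and "affine_dimension A = int CARD('k) - 1"
    and "\<forall>i. column i A $ k0 = 1"
    and "group_closure {column i A - column j A | i j. True} = {v. v $ k0 = 0}"
    and "gale_dual A B"
    and "theta_decomposition B r P"
  shows "int (lambda B) = (\<Sum>j\<le>r. int (dim_L B (P j)) - 1)"
proof (rule antisym)
  have nonzero: "B $ i \<noteq> 0" for i by (rule gale_dual_row_nonzero[OF assms(2,6)])
  have homogeneous: "(\<Sum>i\<in>UNIV. B $ i) = 0" by (rule gale_dual_rows_sum[OF assms(4,6)])
  have P: "cayley_decomposition B r P" "int r - cayley_defect B r P = theta B"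
    using assms(7) by (auto simp: theta_decomposition_def)
  obtain F where "flag B (lambda B) F" "non_splitting B (lambda B) F"
    using lambda_attained by blast
  then show "int (lambda B) \<le> (\<Sum>j\<le>r. int (dim_L B (P j)) - 1)"
    by (rule flag_length_le[OF nonzero P(1)])
  show "(\<Sum>j\<le>r. int (dim_L B (P j)) - 1) \<le> int (lambda B)"
  proof (rule cayley_decomposition_matching_lambda[OF nonzero homogeneous])
    fix s Q
    assume Q: "cayley_decomposition B s Q"
      and le: "(\<Sum>j\<le>s. int (dim_L B (Q j)) - 1) \<le> int (lambda B)"
    have "(\<Sum>j\<le>r. int (dim_L B (P j)) - 1) = int (dim_L B UNIV) - 1 - theta B"
      by (simp only: sum_dim_L_minus_1 P(2))
    also have "\<dots> \<le> (\<Sum>j\<le>s. int (dim_L B (Q j)) - 1)"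
      unfolding sum_dim_L_minus_1 using theta_upper[OF Q] by linarith
    finally show ?thesis using le by linarith
  qed
qed

end
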